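(* Assume in addition that $\dim\mathfrak z=1$. Let $\gamma$ be the geodesic with $\gamma(0)=1$ and $\dot\gamma(0)=z_0+x_0$, $z_0\in\mathfrak z$, $x_0\in\mathfrak v$, and $J=J_{z_0}$; let $-\lambda_1^2,\dots,-\lambda_q^2$ ($\lambda_k>0$, pairwise distinct) be the distinct negative real eigenvalues of $J^2$. (1) If $z_0\neq0$ and $x_0=0$, then $\gamma(t)$ is conjugate to $\gamma(0)$ along $\gamma$ iff $t\in\bigcup_{k=1}^q\frac{2\pi}{\lambda_k}\mathbb Z^*$, and $\mathrm{mult}_{cp}(\frac{2\pi}{\lambda_k}n)=\sum_{h:\,\frac{\lambda_k}{n}\mid\lambda_h}\dim\ker(J^2+\lambda_h^2I)\le\dim\mathfrak v$. (2) If $z_0=0$ and $x_0\neq0$, let $z\in\mathfrak z$ with $\varepsilon:=\langle z,z\rangle\in\{1,-1\}$. Then for $t\neq0$, $\gamma(t)$ is conjugate to $\gamma(0)$ along $\gamma$ iff $-\frac{12}{t^2}=\varepsilon\langle J_zx_0,J_zx_0\rangle$, and then $\mathrm{mult}_{cp}(t)=1$. (3) Suppose $z_0\neq0$, $x_0\neq0$, and $J$ is invertible. Then for $t\neq0$, $\gamma(t)$ is conjugate to $\gamma(0)$ along $\gamma$ iff either $t\in\bigcup_{k=1}^q\frac{2\pi}{\lambda_k}\mathbb Z^*$, or $t\notin\bigcup_{k=1}^q\frac{2\pi}{\lambda_k}\mathbb Z^*$ (so that $e^{-tJ}-I$ is invertible) and $$t\,\langle Jx_0,(e^{-tJ}-I)^{-1}x_0\rangle=\langle\dot\gamma,\dot\gamma\rangle,$$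 in which latter case $\mathrm{mult}_{cp}(t)=1$. For $t=\frac{2\pi}{\lambda_k}n$ ($n\in\mathbb Z^*$), write $S=\sum_{h:\,\frac{\lambda_k}{n}\mid\lambda_h}\dim\ker(J^2+\lambda_h^2I)$. If $x_0\notin\mathrm{im}(e^{-tJ}-I)$, then $\mathrm{mult}_{cp}(t)=S-1$. If $x_0\in\mathrm{im}(e^{-tJ}-I)$, choose $v\in\mathfrak v$ with $(e^{-tJ}-I)v=tx_0$ (the value $\langle Jx_0,v\rangle$ does not depend on the choice); then $\mathrm{mult}_{cp}(t)=S+1$ if $\langle Jx_0,v\rangle=\langle\dot\gamma,\dot\gamma\rangle$, and $\mathrm{mult}_{cp}(t)=S$ otherwise.
   Context: Let $N$ be a connected, simply connected, 2-step nilpotent real Lie group with Lie algebra $\mathfrak n$ and center $\mathfrak z$. Let $\langle\,,\rangle$ be an inner product on $\mathfrak n$, meaning a nondegenerate symmetric bilinear form (possibly indefinite); the same symbol denotes the induced left-invariant pseudo-Riemannian metric on $N$, with Levi-Civita connection $\nabla$. Assume the restriction of $\langle\,,\rangle$ to $\mathfrak z$ is nondegenerate and put $\mathfrak v=\mathfrak z^\perp$, so $\mathfrak n=\mathfrak z\oplus\mathfrak v$ orthogonally. For $z\in\mathfrak z$ define $J_z:\mathfrak v\to\mathfrak v$ by $\langle J_zx,y\rangle=\langle z,[x,y]\rangle$ for all $y\in\mathfrak v$; $J_z$ is skew-adjoint. All tangent spaces of $N$ are identified with $\mathfrak n=T_1N$ via left translation; with this identification the geodesic $\gamma$ with $\gamma(0)=1$,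 $\dot\gamma(0)=z_0+x_0$ satisfies $\dot\gamma(t)=z_0+e^{tJ_{z_0}}x_0$, and $\langle\dot\gamma,\dot\gamma\rangle=\langle z_0,z_0\rangle+\langle x_0,x_0\rangle$ is constant. A Jacobi field along $\gamma$ is a vector field $Y$ along $\gamma$ with $\nabla_{\dot\gamma}\nabla_{\dot\gamma}Y+R(Y,\dot\gamma)\dot\gamma=0$, where $R(X,Y)=\nabla_X\nabla_Y-\nabla_Y\nabla_X-\nabla_{[X,Y]}$. For $t_0\neq0$, $\gamma(t_0)$ is conjugate to $\gamma(0)$ along $\gamma$ if there is a nontrivial Jacobi field $Y$ with $Y(0)=Y(t_0)=0$; its multiplicity $\mathrm{mult}_{cp}(t_0)$ is the dimension of the space of Jacobi fields vanishing at $0$ and $t_0$. $\mathbb Z^*=\mathbb Z\setminus\{0\}$; for real $a,b$, $a\mid b$ means $b$ is a nonzero integer multiple of $a$. *)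

theory Defs
  imports "HOL-Analysis.Analysis" "HOL-Library.Function_Algebras"
begin

text \<open>The Lie algebra n is modelled by a finite-dimensional real vector space 'n
 (class euclidean_space; its built-in Euclidean inner product is NOT used),
 a bracket br and a possibly indefinite scalar product B.\<close>

definition two_step_nilpotent :: "('n::euclidean_space \<Rightarrow> 'n \<Rightarrow> 'n) \<Rightarrow> bool" where
  "two_step_nilpotent br \<longleftrightarrow> bilinear br \<and> (\<forall>x y. br x y = - br y x)
     \<and> (\<forall>x y w. br x (br y w) + br y (br w x) + br w (br x y) = 0)
     \<and> (\<forall>x y w. br (br x y) w = 0) \<and> (\<exists>x y. br x y \<noteq> 0)"

definition inner_product :: "('n::euclidean_space \<Rightarrow> 'n \<Rightarrow> real) \<Rightarrow> bool" where
  "inner_product B \<longleftrightarrow> bilinear B \<and> (\<forall>x y. B x y = B y x) \<and> (\<forall>x. (\<forall>y. B x y = 0) \<longrightarrow> x = 0)"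

definition center :: "('n::euclidean_space \<Rightarrow> 'n \<Rightarrow> 'n) \<Rightarrow> 'n set" where
  "center br = {x. \<forall>y. br x y = 0}"

definition vpart :: "('n::euclidean_space \<Rightarrow> 'n \<Rightarrow> 'n) \<Rightarrow> ('n \<Rightarrow> 'n \<Rightarrow> real) \<Rightarrow> 'n set" where
  "vpart br B = {x. \<forall>w\<in>center br. B w x = 0}"

text \<open>J_z x for x in v: the unique y in v with B y w = B z [x,w] for all w in v.
 (For central x this gives 0, i.e. J_z is extended by 0 on the centre.)\<close>
definition Jop :: "('n::euclidean_space \<Rightarrow> 'n \<Rightarrow> 'n) \<Rightarrow> ('n \<Rightarrow> 'n \<Rightarrow> real) \<Rightarrow> 'n \<Rightarrow> 'n \<Rightarrow> 'n" where
  "Jop br B z x = (THE y. y \<in> vpart br B \<and> (\<forall>w\<in>vpart br B. B y w = B z (br x w)))"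

definition expJ :: "('n::euclidean_space \<Rightarrow> 'n \<Rightarrow> 'n) \<Rightarrow> ('n \<Rightarrow> 'n \<Rightarrow> real) \<Rightarrow> 'n \<Rightarrow> real \<Rightarrow> 'n \<Rightarrow> 'n" where
  "expJ br B z t x = (\<Sum>k. (t ^ k / fact k) *\<^sub>R ((Jop br B z ^^ k) x))"

text \<open>Levi-Civita connection on left-invariant fields (Koszul formula)\<close>
definition nabla :: "('n::euclidean_space \<Rightarrow> 'n \<Rightarrow> 'n) \<Rightarrow> ('n \<Rightarrow> 'n \<Rightarrow> real) \<Rightarrow> 'n \<Rightarrow> 'n \<Rightarrow> 'n" where
  "nabla br B X Y = (THE w. \<forall>Z. B w Z = (B (br X Y) Z - B (br Y Z) X + B (br Z X) Y) / 2)"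

definition curv :: "('n::euclidean_space \<Rightarrow> 'n \<Rightarrow> 'n) \<Rightarrow> ('n \<Rightarrow> 'n \<Rightarrow> real) \<Rightarrow> 'n \<Rightarrow> 'n \<Rightarrow> 'n \<Rightarrow> 'n" where
  "curv br B X Y Z = nabla br B X (nabla br B Y Z) - nabla br B Y (nabla br B X Z) - nabla br B (br X Y) Z"

text \<open>Velocity of the geodesic with gamma(0)=1, gamma'(0)=z0+x0 (left-translated to n)\<close>
definition gvel :: "('n::euclidean_space \<Rightarrow> 'n \<Rightarrow> 'n) \<Rightarrow> ('n \<Rightarrow> 'n \<Rightarrow> real) \<Rightarrow> 'n \<Rightarrow> 'n \<Rightarrow> real \<Rightarrow> 'n" where
  "gvel br B z0 x0 t = z0 + expJ br B z0 t x0"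

text \<open>Jacobi fields along gamma; vector fields along gamma are curves in n via left translation,
 and the covariant derivative is (D Y)(t) = Y'(t) + nabla_{gamma'(t)} Y(t).\<close>
definition jacobi_field :: "('n::euclidean_space \<Rightarrow> 'n \<Rightarrow> 'n) \<Rightarrow> ('n \<Rightarrow> 'n \<Rightarrow> real) \<Rightarrow> 'n \<Rightarrow> 'n \<Rightarrow> (real \<Rightarrow> 'n) \<Rightarrow> bool" where
  "jacobi_field br B z0 x0 Y \<longleftrightarrow> (\<exists>Y1 Y2.
     (\<forall>t. (Y has_vector_derivative Y1 t) (at t)) \<and>
     (\<forall>t. ((\<lambda>s. Y1 s + nabla br B (gvel br B z0 x0 s) (Y s)) has_vector_derivative Y2 t) (at t)) \<and>
     (\<forall>t. Y2 t + nabla br B (gvel br B z0 x0 t) (Y1 t + nabla br B (gvel br B z0 x0 t) (Y t))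
          + curv br B (Y t) (gvel br B z0 x0 t) (gvel br B z0 x0 t) = 0))"

definition conjugate :: "('n::euclidean_space \<Rightarrow> 'n \<Rightarrow> 'n) \<Rightarrow> ('n \<Rightarrow> 'n \<Rightarrow> real) \<Rightarrow> 'n \<Rightarrow> 'n \<Rightarrow> real \<Rightarrow> bool" where
  "conjugate br B z0 x0 t0 \<longleftrightarrow> t0 \<noteq> 0 \<and>
     (\<exists>Y. jacobi_field br B z0 x0 Y \<and> Y \<noteq> (\<lambda>_. 0) \<and> Y 0 = 0 \<and> Y t0 = 0)"

definition mult_cp :: "('n::euclidean_space \<Rightarrow> 'n \<Rightarrow> 'n) \<Rightarrow> ('n \<Rightarrow> 'n \<Rightarrow> real) \<Rightarrow> 'n \<Rightarrow> 'n \<Rightarrow> real \<Rightarrow> nat" where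
  "mult_cp br B z0 x0 t0 = vector_space.dim (\<lambda>r (f::real \<Rightarrow> 'n) s. r *\<^sub>R f s)
     {Y. jacobi_field br B z0 x0 Y \<and> Y 0 = 0 \<and> Y t0 = 0}"

definition lambdas :: "('n::euclidean_space \<Rightarrow> 'n \<Rightarrow> 'n) \<Rightarrow> ('n \<Rightarrow> 'n \<Rightarrow> real) \<Rightarrow> 'n \<Rightarrow> real set" where
  "lambdas br B z = {l. l > 0 \<and> (\<exists>x\<in>vpart br B. x \<noteq> 0 \<and> Jop br B z (Jop br B z x) = - (l^2) *\<^sub>R x)}"

definition kdim :: "('n::euclidean_space \<Rightarrow> 'n \<Rightarrow> 'n) \<Rightarrow> ('n \<Rightarrow> 'n \<Rightarrow> real) \<Rightarrow> 'n \<Rightarrow> real \<Rightarrow> nat" where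
  "kdim br B z l = dim {x\<in>vpart br B. Jop br B z (Jop br B z x) + (l^2) *\<^sub>R x = 0}"

definition rdvd :: "real \<Rightarrow> real \<Rightarrow> bool" where
  "rdvd a b \<longleftrightarrow> (\<exists>m::int. m \<noteq> 0 \<and> b = of_int m * a)"

definition conj_times :: "('n::euclidean_space \<Rightarrow> 'n \<Rightarrow> 'n) \<Rightarrow> ('n \<Rightarrow> 'n \<Rightarrow> real) \<Rightarrow> 'n \<Rightarrow> real set" where
  "conj_times br B z = {2 * pi / l * of_int n | l n. l \<in> lambdas br B z \<and> n \<noteq> 0}"

definition Ssum :: "('n::euclidean_space \<Rightarrow> 'n \<Rightarrow> 'n) \<Rightarrow> ('n \<Rightarrow> 'n \<Rightarrow> real) \<Rightarrow> 'n \<Rightarrow> real \<Rightarrow> int \<Rightarrow> nat" where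
  "Ssum br B z l n = (\<Sum>h\<in>{h\<in>lambdas br B z. rdvd (l / of_int n) h}. kdim br B z h)"

end

theory Submission
  imports Defs
begin

text \<open>
  Write \<open>W = Y' + [\<gamma>', Y]\<close> for a field \<open>Y\<close> along the geodesic. The Jacobi equation says that the central part
  \<open>c e\<close> of \<open>W\<close> is constant and that its part \<open>u\<close> in \<open>V\<close> solves \<open>u' = J u + c L e\<^bsup>tJ\<^esup> x0\<close>. Since
  the centre is a line, \<open>L\<close> and \<open>J\<close> commute, so this is solved in closed form by
  \<open>u = e\<^bsup>tJ\<^esup> (u0 + c t L x0)\<close>. Two further integrations turn the Jacobi fields with \<open>Y 0 = Y t = 0\<close> into the
  solutions \<open>(c, u0)\<close> of a linear system. If \<open>J\<close> is invertible, the substitution \<open>u0 = c x0 + J y\<close> makes it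
  \<open>(e\<^bsup>-tJ\<^esup> - I) y = c t x0\<close>, \<open>c \<langle>\<gamma>', \<gamma>'\<rangle> = \<langle>J x0, y\<rangle>\<close>.

  The kernel of \<open>\<integral>\<^sub>0\<^sup>t e\<^bsup>sJ\<^esup> ds\<close> is the sum of the spaces \<open>ker (J\<^sup>2 + h\<^sup>2)\<close> with \<open>h t\<close> a nonzero
  multiple of \<open>2 \<pi>\<close>, although \<open>J\<close> need not be semisimple: the group \<open>e\<^bsup>sJ\<^esup>\<close> is periodic on it, so averaging
  yields an invariant Euclidean inner product there, for which \<open>J\<^sup>2\<close> is diagonalisable.
\<close>

section \<open>Antiderivatives and one-parameter groups\<close>

text \<open>The signed integral from 0 to \<open>t\<close>: \<open>integral\<close> over a reversed
  interval would be 0, while conjugate times may be negative.\<close>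

definition prim :: "(real \<Rightarrow> 'a::banach) \<Rightarrow> real \<Rightarrow> 'a" where
  "prim f t = (if 0 \<le> t then integral {0..t} f else - integral {t..0} f)"

lemma prim_0 [simp]: "prim f 0 = 0"
  by (simp add: prim_def)

text \<open>Near \<open>t\<close> the function differs by a constant from the integral starting at
  \<open>-M\<close>, where \<open>M\<close> makes both 0 and \<open>t\<close> interior points; the
  fundamental theorem then applies across 0.\<close>

lemma has_vector_derivative_prim:
  fixes f :: "real \<Rightarrow> 'a::banach"
  assumes f: "continuous_on UNIV f"
  shows "(prim f has_vector_derivative f t) (at t)"
proof -
  define M where "M = \<bar>t\<bar> + 1"
  have t: "t \<in> {-M<..<M}" by (auto simp: M_def)
  have cont: "continuous_on {a..b} f" for a b
    using f continuous_on_subset by blast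
  have eq: "integral {-M..s} f - integral {-M..0} f = prim f s" if "s \<in> {-M<..<M}" for s
  proof (cases "0 \<le> s")
    case True
    have "integral {-M..0} f + integral {0..s} f = integral {-M..s} f"
      using that True by (intro Henstock_Kurzweil_Integration.integral_combine integrable_continuous_real cont) auto
    then show ?thesis using True by (simp add: prim_def algebra_simps)
  next
    case False
    have "integral {-M..s} f + integral {s..0} f = integral {-M..0} f"
      using that False by (intro Henstock_Kurzweil_Integration.integral_combine integrable_continuous_real cont) auto
    then show ?thesis using False by (simp add: prim_def algebra_simps)
  qed
  have "((\<lambda>s. integral {-M..s} f) has_vector_derivative f t) (at t within {-M..M})"
    using t by (intro integral_has_vector_derivative cont) auto
  then have "((\<lambda>s. integral {-M..s} f) has_vector_derivative f t) (at t within {-M<..<M})"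
    by (rule has_vector_derivative_within_subset) auto
  then have "((\<lambda>s. integral {-M..s} f) has_vector_derivative f t) (at t)"
    using t by (simp add: at_within_open[of t "{-M<..<M}"])
  then have "((\<lambda>s. integral {-M..s} f - integral {-M..0} f) has_vector_derivative f t) (at t)"
    by (simp add: has_vector_derivative_diff_const)
  then show ?thesis
    by (rule has_vector_derivative_transform_within_open[where S = "{-M<..<M}"]) (use t eq in auto)
qed

text \<open>The device behind the closed formulas below: integrals and conserved quantities are
  identified by comparing derivatives and values at 0.\<close>

lemma has_vector_derivative_unique_at_0:
  fixes f g :: "real \<Rightarrow> 'a::real_normed_vector"
  assumes "\<And>t. (f has_vector_derivative h t) (at t)" "\<And>t. (g has_vector_derivative h t) (at t)" "f 0 = g 0"
  shows "f t = g t"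
proof -
  have "((\<lambda>s. f s - g s) has_derivative (\<lambda>h. 0)) (at x)" for x
    using has_vector_derivative_diff[OF assms(1,2), of x] by (simp add: has_vector_derivative_def)
  then have "f t - g t = f 0 - g 0"
    using has_derivative_zero_unique[of UNIV "\<lambda>s. f s - g s"] by (metis UNIV_I convex_UNIV)
  then show ?thesis using assms(3) by simp
qed

lemma prim_unique:
  fixes f :: "real \<Rightarrow> 'a::banach"
  assumes "continuous_on UNIV f" "\<And>t. (g has_vector_derivative f t) (at t)" "g 0 = 0"
  shows "prim f = g"
  by (rule ext, rule has_vector_derivative_unique_at_0[OF has_vector_derivative_prim[OF assms(1)] assms(2)])
     (simp add: assms)

lemma prim_add:
  fixes f g :: "real \<Rightarrow> 'a::banach"
  assumes "continuous_on UNIV f" "continuous_on UNIV g"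
  shows "prim (\<lambda>s. f s + g s) t = prim f t + prim g t"
  by (rule fun_cong[OF prim_unique[where g = "\<lambda>t. prim f t + prim g t"]])
     (auto intro!: continuous_on_add derivative_eq_intros has_vector_derivative_prim assms)

lemma prim_bounded_linear:
  fixes f :: "real \<Rightarrow> 'a::banach" and h :: "'a \<Rightarrow> 'b::banach"
  assumes "continuous_on UNIV f" "bounded_linear h"
  shows "prim (\<lambda>s. h (f s)) t = h (prim f t)"
  by (rule fun_cong[OF prim_unique[where g = "\<lambda>t. h (prim f t)"]])
     (auto intro!: bounded_linear.continuous_on[OF assms(2)] bounded_linear.has_vector_derivative[OF assms(2)]
        has_vector_derivative_prim assms simp: linear_simps(3)[OF assms(2)])

lemma prim_scaleR:
  fixes f :: "real \<Rightarrow> 'a::banach"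
  assumes "continuous_on UNIV f"
  shows "prim (\<lambda>s. c *\<^sub>R f s) t = c *\<^sub>R prim f t"
  using prim_bounded_linear[OF assms bounded_linear_scaleR_right] .

lemma has_vector_derivative_imp_continuous_on:
  assumes "\<And>t. (f has_vector_derivative f' t) (at t)"
  shows "continuous_on UNIV f"
  using has_vector_derivative_continuous[OF assms] by (simp add: continuous_at_imp_continuous_on)

section \<open>The exponential of a linear map\<close>

definition expT :: "('a::euclidean_space \<Rightarrow> 'a) \<Rightarrow> real \<Rightarrow> 'a \<Rightarrow> 'a" where
  "expT T t x = (\<Sum>k. (t ^ k / fact k) *\<^sub>R (T ^^ k) x)"

lemma summable_expT:
  fixes T :: "'a::euclidean_space \<Rightarrow> 'a"
  assumes T: "linear T"
  shows "summable (\<lambda>k. (t ^ k / fact k) *\<^sub>R (T ^^ k) x)"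
proof -
  obtain K where K: "K > 0" "\<And>y. norm (T y) \<le> K * norm y"
    using linear_bounded_pos[OF T] by blast
  then have K0: "norm (T y) \<le> \<bar>K\<bar> * norm y" for y by simp
  have pow: "norm ((T ^^ k) x) \<le> \<bar>K\<bar> ^ k * norm x" for k
  proof (induction k)
    case (Suc k)
    have "norm ((T ^^ Suc k) x) \<le> \<bar>K\<bar> * norm ((T ^^ k) x)" using K0 by simp
    also have "\<dots> \<le> \<bar>K\<bar> * (\<bar>K\<bar> ^ k * norm x)" using Suc by (simp add: mult_left_mono)
    finally show ?case by (simp add: mult.assoc)
  qed simp
  have "summable (\<lambda>k. norm x * ((\<bar>t\<bar> * \<bar>K\<bar>) ^ k / fact k))"
    using summable_exp[of "\<bar>t\<bar> * \<bar>K\<bar>"] by (intro summable_mult) (simp add: field_simps)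
  then show ?thesis
  proof (rule summable_comparison_test'[where N = 0])
    fix k
    have "norm ((t ^ k / fact k) *\<^sub>R (T ^^ k) x) = \<bar>t\<bar> ^ k / fact k * norm ((T ^^ k) x)"
      by (simp add: power_abs)
    also have "\<dots> \<le> \<bar>t\<bar> ^ k / fact k * (\<bar>K\<bar> ^ k * norm x)"
      using pow[of k] by (intro mult_left_mono) auto
    finally show "norm ((t ^ k / fact k) *\<^sub>R (T ^^ k) x) \<le> norm x * ((\<bar>t\<bar> * \<bar>K\<bar>) ^ k / fact k)"
      by (simp add: power_mult_distrib field_simps)
  qed
qed

lemma expT_commute:
  fixes T S :: "'a::euclidean_space \<Rightarrow> 'a"
  assumes T: "linear T" and S: "linear S" and c: "\<And>x. S (T x) = T (S x)"
  shows "S (expT T t x) = expT T t (S x)"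
proof -
  have p: "S ((T ^^ k) x) = (T ^^ k) (S x)" for k by (induction k) (simp_all add: c)
  have "S (expT T t x) = (\<Sum>k. S ((t ^ k / fact k) *\<^sub>R (T ^^ k) x))"
    unfolding expT_def by (rule bounded_linear.suminf[OF _ summable_expT[OF T]]) (use S in \<open>simp add: linear_conv_bounded_linear\<close>)
  then show ?thesis by (simp add: linear_scale[OF S] p expT_def)
qed

text \<open>Each Euclidean coordinate is a scalar power series in \<open>t\<close>; termwise
  differentiation shifts its coefficients to those of the series at \<open>T x\<close>, and
  \<open>T\<close> commutes with its exponential.\<close>

lemma has_vector_derivative_expT:
  fixes T :: "'a::euclidean_space \<Rightarrow> 'a"
  assumes T: "linear T"
  shows "((\<lambda>t. expT T t x) has_vector_derivative T (expT T t x)) (at t)"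
proof -
  have inner: "expT T s y \<bullet> b = (\<Sum>k. ((T ^^ k) y \<bullet> b / fact k) * s ^ k)"
    and sm: "summable (\<lambda>k. ((T ^^ k) y \<bullet> b / fact k) * s ^ k)" for s y b
    unfolding expT_def
    using bounded_linear.suminf[OF bounded_linear_inner_left summable_expT[OF T, of s y], of b]
      bounded_linear.summable[OF bounded_linear_inner_left summable_expT[OF T, of s y], of b]
    by (simp_all add: mult.commute)
  have "((\<lambda>s. expT T s x \<bullet> b) has_vector_derivative T (expT T t x) \<bullet> b) (at t)" for b
  proof -
    have "diffs (\<lambda>k. (T ^^ k) x \<bullet> b / fact k) = (\<lambda>k. (T ^^ k) (T x) \<bullet> b / fact k)"
      by (simp add: diffs_def fun_eq_iff funpow_swap1 del: of_nat_Suc)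
    then have "T (expT T t x) \<bullet> b = (\<Sum>n. diffs (\<lambda>k. (T ^^ k) x \<bullet> b / fact k) n * t ^ n)"
      using inner[of t "T x" b] expT_commute[OF T T refl, of t x] by simp
    then show ?thesis
      using termdiffs_strong_converges_everywhere[OF sm[where y = x and b = b], of t]
      by (simp add: inner has_real_derivative_iff_has_vector_derivative)
  qed
  then show ?thesis
    unfolding has_vector_derivative_def by (subst has_derivative_componentwise_within) simp
qed

lemma expT_0 [simp]: "expT T 0 x = x"
proof -
  have "(\<lambda>k. (0 ^ k / fact k) *\<^sub>R (T ^^ k) x) = (\<lambda>k. if k = 0 then x else 0)" by (auto simp: power_0_left)
  then show ?thesis unfolding expT_def using sums_If_finite[of "\<lambda>k. k = (0::nat)" "\<lambda>_. x"]
    by (simp add: sums_iff)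
qed

text \<open>A Gronwall estimate: with norm bound \<open>K\<close> for \<open>T\<close>, the squared
  norm of \<open>g\<close> times \<open>exp (-2 K t)\<close> does not increase, which settles
  positive times, and times \<open>exp (2 K t)\<close> does not decrease, which settles negative
  ones.\<close>

lemma linear_ode_zero:
  fixes T :: "'a::euclidean_space \<Rightarrow> 'a"
  assumes T: "linear T" and g: "\<And>t. (g has_vector_derivative T (g t)) (at t)" and g0: "g 0 = 0"
  shows "g t = 0"
proof -
  obtain K where K: "\<And>y. norm (T y) \<le> K * norm y"
    using linear_bounded[OF T] by blast
  have CS: "\<bar>g s \<bullet> T (g s)\<bar> \<le> K * (g s \<bullet> g s)" for s
  proof -
    have "\<bar>g s \<bullet> T (g s)\<bar> \<le> norm (g s) * norm (T (g s))" by (rule Cauchy_Schwarz_ineq2)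
    also have "\<dots> \<le> norm (g s) * (K * norm (g s))" by (intro mult_left_mono K) auto
    finally show ?thesis by (simp add: dot_square_norm power2_eq_square mult_ac)
  qed
  have d: "((\<lambda>s. g s \<bullet> g s) has_real_derivative 2 * (g s \<bullet> T (g s))) (at s)" for s
    unfolding has_real_derivative_iff_has_vector_derivative
    by (rule has_vector_derivative_eq_rhs[OF bounded_bilinear.has_vector_derivative[OF bounded_bilinear_inner g g]])
       (simp add: inner_commute)
  have e: "((\<lambda>s. exp (c * s) * (g s \<bullet> g s)) has_real_derivative exp (c * s) * (c * (g s \<bullet> g s) + 2 * (g s \<bullet> T (g s)))) (at s)" for c s
    by (auto intro!: derivative_eq_intros d simp: algebra_simps)
  have "g t \<bullet> g t \<le> 0"
  proof (cases "0 \<le> t")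
    case True
    have "exp (- (2*K) * t) * (g t \<bullet> g t) \<le> exp (- (2*K) * 0) * (g 0 \<bullet> g 0)"
    proof (rule DERIV_nonpos_imp_nonincreasing[OF True])
      fix s show "\<exists>y. ((\<lambda>s. exp (- (2*K) * s) * (g s \<bullet> g s)) has_real_derivative y) (at s) \<and> y \<le> 0"
        using CS[of s] by (intro exI[of _ "exp (- (2*K) * s) * (- (2*K) * (g s \<bullet> g s) + 2 * (g s \<bullet> T (g s)))"] conjI e) (auto simp: mult_le_0_iff)
    qed
    then show ?thesis using g0 by (simp add: mult_le_0_iff)
  next
    case False
    have "exp (2*K * t) * (g t \<bullet> g t) \<le> exp (2*K * 0) * (g 0 \<bullet> g 0)"
    proof (rule DERIV_nonneg_imp_nondecreasing[where f = "\<lambda>s. exp (2*K * s) * (g s \<bullet> g s)"])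
      show "t \<le> 0" using False by simp
      fix s show "\<exists>y. ((\<lambda>s. exp (2*K * s) * (g s \<bullet> g s)) has_real_derivative y) (at s) \<and> y \<ge> 0"
        using CS[of s] by (intro exI[of _ "exp (2*K * s) * (2*K * (g s \<bullet> g s) + 2 * (g s \<bullet> T (g s)))"] conjI e) auto
    qed
    then show ?thesis using g0 by (simp add: mult_le_0_iff)
  qed
  then show ?thesis using inner_ge_zero[of "g t"] by (metis antisym inner_eq_zero_iff)
qed

text \<open>The group law, additivity and the explicit rotations follow from this by exhibiting a
  solution of the linear equation.\<close>

lemma expT_unique:
  fixes T :: "'a::euclidean_space \<Rightarrow> 'a"
  assumes T: "linear T" and g: "\<And>t. (g has_vector_derivative T (g t)) (at t)"
  shows "g t = expT T t (g 0)"
proof -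
  have "g t - expT T t (g 0) = 0"
    by (rule linear_ode_zero[OF T, of "\<lambda>t. g t - expT T t (g 0)"])
       (auto intro!: derivative_eq_intros g has_vector_derivative_expT T simp: linear_diff[OF T])
  then show ?thesis by simp
qed

lemma expT_add:
  fixes T :: "'a::euclidean_space \<Rightarrow> 'a"
  assumes T: "linear T"
  shows "expT T s (expT T t x) = expT T (s + t) x"
  using expT_unique[OF T, of "\<lambda>s. expT T (s + t) x" s]
    has_vector_derivative_shift has_vector_derivative_expT[OF T, of x]
    vector_diff_chain_at[of "\<lambda>s. s + t" 1 _ "\<lambda>s. expT T s x"]
  by (auto simp: o_def has_vector_derivative_add_const)

lemma expT_minus [simp]:
  fixes T :: "'a::euclidean_space \<Rightarrow> 'a"
  assumes T: "linear T"
  shows "expT T (- t) (expT T t x) = x" "expT T t (expT T (- t) x) = x"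
  by (simp_all add: expT_add[OF T])

lemma linear_expT:
  fixes T :: "'a::euclidean_space \<Rightarrow> 'a"
  assumes T: "linear T"
  shows "linear (expT T t)"
proof (rule linearI)
  fix x y c
  show "expT T t (x + y) = expT T t x + expT T t y"
    by (rule expT_unique[OF T, of "\<lambda>t. expT T t x + expT T t y" t, simplified, symmetric])
       (auto intro!: derivative_eq_intros has_vector_derivative_expT T simp: linear_add[OF T])
  show "expT T t (c *\<^sub>R x) = c *\<^sub>R expT T t x"
    using expT_commute[OF T, of "\<lambda>x. c *\<^sub>R x" t x] linear_scale[OF T] by simp
qed

lemma continuous_on_expT:
  fixes T :: "'a::euclidean_space \<Rightarrow> 'a"
  assumes T: "linear T"
  shows "continuous_on UNIV (\<lambda>t. expT T t x)"
  by (rule has_vector_derivative_imp_continuous_on[OF has_vector_derivative_expT[OF T]])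

lemma expT_in_subspace:
  fixes T :: "'a::euclidean_space \<Rightarrow> 'a"
  assumes T: "linear T" and V: "subspace V" and inv: "\<And>x. x \<in> V \<Longrightarrow> T x \<in> V" and x: "x \<in> V"
  shows "expT T t x \<in> V"
proof -
  have "(T ^^ k) x \<in> V" for k by (induction k) (auto simp: inv x)
  then have "(\<Sum>k<n. (t ^ k / fact k) *\<^sub>R (T ^^ k) x) \<in> V" for n
    by (intro subspace_sum[OF V] subspace_scale[OF V])
  then show ?thesis
    unfolding expT_def
    by (rule closed_sequentially[OF closed_subspace[OF V] _ summable_LIMSEQ[OF summable_expT[OF T]]])
qed

lemma expT_rotation:
  fixes T :: "'a::euclidean_space \<Rightarrow> 'a"
  assumes T: "linear T" and h: "h \<noteq> 0" and x: "T (T x) = - (h\<^sup>2) *\<^sub>R x"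
  shows "expT T t x = cos (h * t) *\<^sub>R x + (sin (h * t) / h) *\<^sub>R T x"
  by (rule expT_unique[OF T, of "\<lambda>t. cos (h * t) *\<^sub>R x + (sin (h * t) / h) *\<^sub>R T x" t, simplified, symmetric])
     (use h in \<open>auto intro!: derivative_eq_intros simp: linear_add[OF T] linear_scale[OF T] x power2_eq_square\<close>)

section \<open>Periodic one-parameter groups and eigenspaces\<close>

lemma real_quadratic_nonneg_imp:
  fixes b c :: real
  assumes "\<And>s. 0 \<le> s * b + s\<^sup>2 * c"
  shows "b = 0"
proof (rule ccontr)
  assume "b \<noteq> 0"
  \<comment> \<open>Any positive \<open>d > c\<close> works: at \<open>s = - b / d\<close> the
    quadratic equals \<open>b^2 (c - d) / d^2 < 0\<close>.\<close>
  define d where "d = \<bar>c\<bar> + 1"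
  have d: "d > 0" "c < d" by (auto simp: d_def)
  have "(- b / d) * b + (- b / d)\<^sup>2 * c = b\<^sup>2 * (c - d) / d\<^sup>2"
    using d by (simp add: field_simps power2_eq_square)
  also have "\<dots> < 0" using d \<open>b \<noteq> 0\<close> by (simp add: divide_neg_pos mult_pos_neg)
  finally show False using assms[of "- b / d"] by linarith
qed

text \<open>The Rayleigh quotient of \<open>T\<close> with respect to \<open>A\<close> attains its
  maximum on the compact Euclidean unit sphere of \<open>U\<close>, and the vanishing first
  variation makes a maximiser an eigenvector.\<close>

lemma self_adjoint_has_eigenvector:
  fixes T :: "'a::euclidean_space \<Rightarrow> 'a" and A :: "'a \<Rightarrow> 'a \<Rightarrow> real"
  assumes T: "linear T" and A: "bilinear A" and U: "subspace U" and TU: "\<And>x. x \<in> U \<Longrightarrow> T x \<in> U"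
    and sym: "\<And>x y. x \<in> U \<Longrightarrow> y \<in> U \<Longrightarrow> A x y = A y x"
    and pos: "\<And>x. x \<in> U \<Longrightarrow> x \<noteq> 0 \<Longrightarrow> A x x > 0"
    and adj: "\<And>x y. x \<in> U \<Longrightarrow> y \<in> U \<Longrightarrow> A (T x) y = A x (T y)"
    and x0: "x0 \<in> U" "x0 \<noteq> 0"
  shows "\<exists>w\<in>U. w \<noteq> 0 \<and> (\<exists>c. T w = c *\<^sub>R w)"
proof -
  define S where "S = U \<inter> sphere 0 1"
  define f where "f x = A (T x) x / A x x" for x
  note Abil = bilinear_ladd[OF A] bilinear_radd[OF A] bilinear_lmul[OF A] bilinear_rmul[OF A]
    bilinear_lsub[OF A] bilinear_rsub[OF A]
  have bb: "bounded_bilinear A" using A by (simp add: bilinear_conv_bounded_bilinear)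
  have bT: "bounded_linear T" using T by (simp add: linear_conv_bounded_linear)
  have "compact S" unfolding S_def using closed_subspace[OF U] by (simp add: closed_Int_compact)
  moreover have "(1 / norm x0) *\<^sub>R x0 \<in> S" using x0 subspace_scale[OF U] by (simp add: S_def)
  moreover have "continuous_on S f"
    unfolding f_def
    by (intro continuous_on_divide bounded_bilinear.continuous_on[OF bb] continuous_on_id
        bounded_linear.continuous_on[OF bT]) (use pos in \<open>force simp: S_def\<close>)
  ultimately obtain w where w: "w \<in> S" "\<And>y. y \<in> S \<Longrightarrow> f y \<le> f w"
    using continuous_attains_sup[of S f] by blast
  have wU: "w \<in> U" and w0: "w \<noteq> 0" using w by (auto simp: S_def)
  \<comment> \<open>\<open>Q\<close> is nonnegative on \<open>U\<close> and zero at the maximiser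
    \<open>w\<close>, so it has no first-order term there.\<close>
  define Q where "Q y = f w * A y y - A (T y) y" for y
  have Q0: "Q y \<ge> 0" if y: "y \<in> U" for y
  proof (cases "y = 0")
    case True
    then show ?thesis using bilinear_lzero[OF A] by (simp add: Q_def linear_0[OF T])
  next
    case False
    define r where "r = 1 / norm y"
    have r: "r > 0" using False by (simp add: r_def)
    have "f (r *\<^sub>R y) \<le> f w" using False y by (intro w) (auto simp: S_def r_def subspace_scale[OF U])
    also have "f (r *\<^sub>R y) = f y" using r by (simp add: f_def linear_scale[OF T] Abil)
    finally show ?thesis using pos[OF y False] by (simp add: f_def Q_def field_simps)
  qed
  \<comment> \<open>The first-order term of \<open>Q\<close> at \<open>w\<close> in the direction of
    this residual is \<open>2 * A r r\<close>, so positivity of \<open>A\<close> forces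
    \<open>r = 0\<close>.\<close>
  define r where "r = f w *\<^sub>R w - T w"
  have rU: "r \<in> U" using wU by (simp add: r_def subspace_diff[OF U] subspace_scale[OF U] TU)
  have "2 * A r r = 0"
  proof (rule real_quadratic_nonneg_imp)
    fix s
    have "Q w = 0" using pos[OF wU w0] by (simp add: Q_def f_def)
    moreover have "Q (w + s *\<^sub>R r) = Q w + s * (2 * (f w * A w r - A (T w) r)) + s\<^sup>2 * Q r"
      using sym[OF wU rU] adj[OF rU wU] sym[OF rU TU[OF wU]]
      by (simp add: Q_def linear_add[OF T] linear_scale[OF T] Abil algebra_simps power2_eq_square)
    moreover have "f w * A w r - A (T w) r = A r r"
      by (subst (3) r_def) (simp add: Abil)
    moreover have "Q (w + s *\<^sub>R r) \<ge> 0" by (intro Q0 subspace_add[OF U] subspace_scale[OF U] wU rU)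
    ultimately show "0 \<le> s * (2 * A r r) + s\<^sup>2 * Q r" by simp
  qed
  then have "r = 0" using pos[OF rU] by fastforce
  then show ?thesis using wU w0 by (auto simp: r_def intro!: bexI[of _ w] exI[of _ "f w"])
qed

text \<open>Induction on the dimension: the \<open>A\<close>-orthogonal complement of an eigenvector
  is again invariant under \<open>T\<close>, and it is smaller because the eigenvector is not in
  it.\<close>

lemma self_adjoint_diagonalizable:
  fixes T :: "'a::euclidean_space \<Rightarrow> 'a" and A :: "'a \<Rightarrow> 'a \<Rightarrow> real"
  assumes T: "linear T" and A: "bilinear A" and U: "subspace U" and TU: "\<And>x. x \<in> U \<Longrightarrow> T x \<in> U"
    and sym: "\<And>x y. x \<in> U \<Longrightarrow> y \<in> U \<Longrightarrow> A x y = A y x"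
    and pos: "\<And>x. x \<in> U \<Longrightarrow> x \<noteq> 0 \<Longrightarrow> A x x > 0"
    and adj: "\<And>x y. x \<in> U \<Longrightarrow> y \<in> U \<Longrightarrow> A (T x) y = A x (T y)"
  shows "U \<subseteq> span {x \<in> U. \<exists>c. T x = c *\<^sub>R x}"
  using U TU sym pos adj
proof (induction "dim U" arbitrary: U rule: less_induct)
  case (less U)
  show ?case
  proof (cases "U \<subseteq> {0}")
    case True
    then show ?thesis using span_0 by blast
  next
    case False
    then obtain u where u: "u \<in> U" "u \<noteq> 0" by auto
    from self_adjoint_has_eigenvector[OF T A less.prems u]
    obtain w c where w: "w \<in> U" "w \<noteq> 0" "T w = c *\<^sub>R w"
      by auto
    define U' where "U' = {v \<in> U. A v w = 0}"
    have U': "subspace U'"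
      using less.prems(1) bilinear_ladd[OF A] bilinear_lmul[OF A] bilinear_lzero[OF A]
      by (auto simp: U'_def subspace_def)
    have sub: "U' \<subseteq> U" by (auto simp: U'_def)
    have "w \<notin> U'" using less.prems(4)[OF w(1,2)] by (simp add: U'_def)
    then have "dim U' < dim U"
      using subspace_dim_equal[OF U' less.prems(1) sub] w(1) by (metis not_le)
    then have "U' \<subseteq> span {x \<in> U'. \<exists>c. T x = c *\<^sub>R x}"
    proof (rule less.hyps[OF _ U'])
      show "T x \<in> U'" if "x \<in> U'" for x
        using that less.prems(2,5) w by (simp add: U'_def bilinear_rmul[OF A])
    next
      fix x y assume "x \<in> U'" "y \<in> U'"
      then have xy: "x \<in> U" "y \<in> U" using sub by auto
      show "A x y = A y x" "A (T x) y = A x (T y)"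
        by (rule less.prems(3)[OF xy] less.prems(5)[OF xy])+
    next
      fix x assume "x \<in> U'" "x \<noteq> 0"
      then show "A x x > 0" using less.prems(4) sub by blast
    qed
    also have "\<dots> \<subseteq> span {x \<in> U. \<exists>c. T x = c *\<^sub>R x}" using sub by (intro span_mono) auto
    finally have IH: "U' \<subseteq> span {x \<in> U. \<exists>c. T x = c *\<^sub>R x}" .
    show ?thesis
    proof
      fix u assume u: "u \<in> U"
      define k where "k = A u w / A w w"
      have "u - k *\<^sub>R w \<in> U'"
        using u w less.prems(4)[OF w(1,2)]
        by (simp add: U'_def k_def subspace_diff[OF less.prems(1)] subspace_scale[OF less.prems(1)]
            bilinear_lsub[OF A] bilinear_lmul[OF A])
      moreover have "k *\<^sub>R w \<in> span {x \<in> U. \<exists>c. T x = c *\<^sub>R x}"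
        using w by (intro span_scale span_base) auto
      ultimately have "(u - k *\<^sub>R w) + k *\<^sub>R w \<in> span {x \<in> U. \<exists>c. T x = c *\<^sub>R x}"
        using IH by (intro span_add) auto
      then show "u \<in> span {x \<in> U. \<exists>c. T x = c *\<^sub>R x}" by simp
    qed
  qed
qed

lemma periodic_spanned_by_eigenvectors:
  fixes T :: "'a::euclidean_space \<Rightarrow> 'a"
  assumes T: "linear T" and U: "subspace U" and TU: "\<And>x. x \<in> U \<Longrightarrow> T x \<in> U"
    and inj: "\<And>x. x \<in> U \<Longrightarrow> T x = 0 \<Longrightarrow> x = 0"
    and t: "t \<noteq> 0" and per: "\<And>x. x \<in> U \<Longrightarrow> expT T t x = x"
  shows "U \<subseteq> span (\<Union>h\<in>{h. h > 0 \<and> (\<exists>m::int. m \<noteq> 0 \<and> h * t = 2 * pi * m)}. {x \<in> U. T (T x) = - (h\<^sup>2) *\<^sub>R x})"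
proof -
  text \<open>Averaging the Euclidean inner product over the period gives a positive definite form for which
    \<open>T\<close> is skew, so that \<open>T\<^sup>2\<close> is self-adjoint.\<close>
  define r where "r = \<bar>t\<bar>"
  have r: "r > 0" using t by (simp add: r_def)
  have perr: "expT T r x = x" if "x \<in> U" for x
    using per[OF that] expT_minus(1)[OF T, of t x] by (auto simp: r_def abs_if)
  define g where "g x y s = expT T s x \<bullet> expT T s y" for x y s
  define A where "A x y = prim (g x y) r" for x y
  have g_deriv: "(g x y has_vector_derivative g (T x) y s + g x (T y) s) (at s)" for x y s
    unfolding g_def
    by (rule has_vector_derivative_eq_rhs[OF bounded_bilinear.has_vector_derivative[OF bounded_bilinear_inner
          has_vector_derivative_expT[OF T] has_vector_derivative_expT[OF T]]])
       (simp add: expT_commute[OF T T refl])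
  have g_cont: "continuous_on UNIV (g x y)" for x y
    by (rule has_vector_derivative_imp_continuous_on[OF g_deriv])
  have prim_deriv: "A (T x) y + A x (T y) = g x y r - g x y 0" for x y
  proof -
    have "A (T x) y + A x (T y) = prim (\<lambda>s. g (T x) y s + g x (T y) s) r"
      by (simp add: A_def prim_add g_cont)
    also have "prim (\<lambda>s. g (T x) y s + g x (T y) s) = (\<lambda>s. g x y s - g x y 0)"
      by (rule prim_unique) (auto intro!: continuous_on_add g_cont derivative_eq_intros g_deriv)
    finally show ?thesis .
  qed
  \<comment> \<open>The sum \<open>A (T x) y + A x (T y)\<close> integrates the derivative of
    \<open>g x y\<close> over a full period, after which \<open>g x y\<close> returns to its initial
    value.\<close>
  have skew: "A (T x) y = - A x (T y)" if "x \<in> U" "y \<in> U" for x y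
    using prim_deriv[of x y] perr that by (simp add: g_def)
  have lin: "linear (A x)" for x
  proof (rule linearI)
    fix y z c
    show "A x (y + z) = A x y + A x z"
      using prim_add[OF g_cont g_cont, of x y x z r]
      by (simp add: A_def g_def[abs_def] linear_add[OF linear_expT[OF T]] inner_add_right)
    show "A x (c *\<^sub>R y) = c *\<^sub>R A x y"
      using prim_scaleR[OF g_cont, of c x y r]
      by (simp add: A_def g_def[abs_def] linear_scale[OF linear_expT[OF T]])
  qed
  have comm: "A x y = A y x" for x y
    unfolding A_def g_def by (simp add: inner_commute)
  have "(\<lambda>x. A x y) = A y" for y by (rule ext) (rule comm)
  then have bil: "bilinear A" unfolding bilinear_def using lin by simp
  have pos: "A x x > 0" if "x \<noteq> 0" for x
  proof -
    have "expT T s x \<noteq> 0" for s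
      using that expT_minus(1)[OF T, of s x] linear_0[OF linear_expT[OF T]] by metis
    then have "g x x s > 0" for s by (simp add: g_def)
    then have "prim (g x x) 0 < prim (g x x) r"
      using has_vector_derivative_prim[OF g_cont, of x x]
      by (intro DERIV_pos_imp_increasing[OF r]) (auto simp flip: has_real_derivative_iff_has_vector_derivative)
    then show ?thesis by (simp add: A_def)
  qed
  have "A (T (T x)) y = A x (T (T y))" if "x \<in> U" "y \<in> U" for x y
    using skew[OF TU that(2), OF that(1)] skew[OF _ TU, of x y] that TU by simp
  then have "U \<subseteq> span {x \<in> U. \<exists>c. T (T x) = c *\<^sub>R x}"
    by (intro self_adjoint_diagonalizable[OF linear_compose[OF T T, unfolded o_def] bil U] TU comm pos) auto
  also have "\<dots> \<subseteq> span (\<Union>h\<in>{h. h > 0 \<and> (\<exists>m::int. m \<noteq> 0 \<and> h * t = 2 * pi * m)}. {x \<in> U. T (T x) = - (h\<^sup>2) *\<^sub>R x})"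
    (is "_ \<subseteq> span ?S")
  proof (rule span_minimal, safe)
    fix x c assume x: "x \<in> U" and c: "T (T x) = c *\<^sub>R x"
    show "x \<in> span ?S"
    proof (cases "x = 0")
      case True then show ?thesis by (simp add: span_0)
    next
      case False
      \<comment> \<open>Skewness makes the eigenvalues of \<open>T^2\<close> nonpositive, and
        injectivity of \<open>T\<close> on \<open>U\<close> makes them negative.\<close>
      have "c * A x x = A (T (T x)) x" by (simp add: c bilinear_lmul[OF bil])
      also have "\<dots> = - A (T x) (T x)" using skew x TU by blast
      also have "\<dots> < 0" using pos inj x False by force
      finally have "c < 0" using pos[OF False] by (simp add: mult_less_0_iff)
      define h where "h = sqrt (- c)"
      have h: "h > 0" "c = - (h\<^sup>2)" using \<open>c < 0\<close> by (auto simp: h_def)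
      have rot: "x = cos (h * t) *\<^sub>R x + (sin (h * t) / h) *\<^sub>R T x"
        using per[OF x] expT_rotation[OF T, of h x t] c h by simp
      \<comment> \<open>A nonzero sine would make \<open>x\<close> a real eigenvector of
        \<open>T\<close>, with \<open>k^2 = -h^2\<close>.\<close>
      have s0: "sin (h * t) / h = 0"
      proof (rule ccontr)
        assume s: "sin (h * t) / h \<noteq> 0"
        define k where "k = (1 - cos (h * t)) / (sin (h * t) / h)"
        have "(sin (h * t) / h) *\<^sub>R T x = (1 - cos (h * t)) *\<^sub>R x"
          using rot by (simp add: algebra_simps)
        then have "(sin (h * t) / h) *\<^sub>R T x = (sin (h * t) / h) *\<^sub>R (k *\<^sub>R x)"
          using s by (simp add: k_def)
        then have Tx: "T x = k *\<^sub>R x" using s by (metis scaleR_cancel_left)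
        then have "- (h\<^sup>2) *\<^sub>R x = k\<^sup>2 *\<^sub>R x" using c h by (simp add: linear_scale[OF T] power2_eq_square)
        then have "- (h\<^sup>2) = k\<^sup>2" using False by (metis scaleR_cancel_right)
        then show False using h(1) zero_le_power2[of k] by (metis neg_less_0_iff_less not_le zero_less_power)
      qed
      then have "cos (h * t) *\<^sub>R x = 1 *\<^sub>R x" using rot unfolding s0 by simp
      then have "cos (h * t) = 1" using False by (metis scaleR_cancel_right)
      then obtain m :: int where m: "h * t = m * 2 * pi" by (auto simp: cos_one_2pi_int)
      then have "m \<noteq> 0" using h t by auto
      then show ?thesis using x c h m by (intro span_base UN_I[of h]) (auto simp: mult_ac)
    qed
  qed
  finally show ?thesis .
qed

text \<open>The map \<open>M - b\<close> kills the component of \<open>x\<close> in the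
  \<open>b\<close>-eigenspace and multiplies \<open>x\<close> by \<open>a - b\<close>, so
  \<open>(a - b) x\<close> is an \<open>a\<close>-eigenvector in the span belonging to the smaller
  set \<open>C\<close>.\<close>

lemma eigenspaces_independent:
  fixes M :: "'a::real_vector \<Rightarrow> 'a"
  assumes M: "linear M" and "finite C" "a \<notin> C" "M x = a *\<^sub>R x"
    and "x \<in> span (\<Union>c\<in>C. {x \<in> V. M x = c *\<^sub>R x})"
  shows "x = 0"
  using assms(2-)
proof (induction C arbitrary: x rule: finite_induct)
  case (insert b C)
  let ?W = "span (\<Union>c\<in>C. {x \<in> V. M x = c *\<^sub>R x})"
  have inv: "M z \<in> ?W" if "z \<in> ?W" for z
    using that
  proof (induction rule: span_induct_alt)
    case base show ?case by (simp add: linear_0[OF M] span_0)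
  next
    case (step k y z)
    obtain c where "M y = c *\<^sub>R y" using step(1) by auto
    then have "M y \<in> ?W" using step(1) by (simp only: span_scale span_base)
    then show ?case by (simp add: linear_add[OF M] linear_scale[OF M] span_add span_scale step)
  qed
  obtain y z where yz: "x = y + z" "y \<in> span {x \<in> V. M x = b *\<^sub>R x}" "z \<in> ?W"
    using insert.prems(3) by (auto simp: span_Un)
  have "span {x \<in> V. M x = b *\<^sub>R x} \<subseteq> {x. M x = b *\<^sub>R x}"
    by (rule span_minimal) (auto simp: subspace_def linear_add[OF M] linear_scale[OF M] linear_0[OF M] algebra_simps)
  then have "M y = b *\<^sub>R y" using yz by auto
  then have "(a - b) *\<^sub>R x = M z - b *\<^sub>R z"
    using insert.prems(2) yz(1) by (simp add: linear_add[OF M] algebra_simps)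
  then have "(a - b) *\<^sub>R x \<in> ?W" using yz inv by (simp add: span_diff span_scale)
  then have "(a - b) *\<^sub>R x = 0"
    using insert.prems by (intro insert.IH) (auto simp: linear_scale[OF M])
  then show ?case using insert.prems by auto
qed simp

lemma subspace_eigenspace:
  fixes M :: "'a::real_vector \<Rightarrow> 'a"
  assumes "linear M" "subspace V"
  shows "subspace {x \<in> V. M x = c *\<^sub>R x}"
  using assms by (auto simp: subspace_def linear_add linear_scale linear_0 algebra_simps)

lemma dim_span_eigenspaces:
  fixes M :: "'a::euclidean_space \<Rightarrow> 'a"
  assumes M: "linear M" and V: "subspace V" and "finite C"
  shows "dim (span (\<Union>c\<in>C. {x \<in> V. M x = c *\<^sub>R x})) = (\<Sum>c\<in>C. dim {x \<in> V. M x = c *\<^sub>R x})"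
  using assms(3)
proof (induction C rule: finite_induct)
  case (insert b C)
  let ?W = "span (\<Union>c\<in>C. {x \<in> V. M x = c *\<^sub>R x})" and ?E = "{x \<in> V. M x = b *\<^sub>R x}"
  have E: "subspace ?E" by (rule subspace_eigenspace[OF M V])
  have "x = 0" if "x \<in> ?E \<inter> ?W" for x
    using that by (intro eigenspaces_independent[OF M insert.hyps, of x V]) simp_all
  then have "?E \<inter> ?W \<subseteq> {0}" by blast
  then have Int: "dim (?E \<inter> ?W) = 0" by (simp only: dim_eq_0)
  have E': "span ?E = ?E" using E by (simp only: span_eq_iff)
  have "dim (span (\<Union>c\<in>insert b C. {x \<in> V. M x = c *\<^sub>R x})) = dim {x + y |x y. x \<in> ?E \<and> y \<in> ?W}"
    unfolding UN_insert span_Un E' ..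
  also have "\<dots> = dim ?E + dim ?W"
    using dim_sums_Int[OF E subspace_span, of "\<Union>c\<in>C. {x \<in> V. M x = c *\<^sub>R x}"] unfolding Int by linarith
  also have "\<dots> = (\<Sum>c\<in>insert b C. dim {x \<in> V. M x = c *\<^sub>R x})"
    unfolding insert.IH sum.insert[OF insert.hyps] ..
  finally show ?case .
qed simp

text \<open>Independent nonzero eigenspaces each use up a dimension. Finiteness matters for
  \<open>Ssum\<close>, as \<open>sum\<close> over an infinite set would be 0.\<close>

lemma finite_eigenvalues:
  fixes M :: "'a::euclidean_space \<Rightarrow> 'a"
  assumes M: "linear M" and V: "subspace V"
  shows "finite {c. \<exists>x\<in>V. x \<noteq> 0 \<and> M x = c *\<^sub>R x}"
proof (rule finite_if_finite_subsets_card_bdd[of _ "DIM('a)", THEN conjunct1])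
  fix C assume C: "C \<subseteq> {c. \<exists>x\<in>V. x \<noteq> 0 \<and> M x = c *\<^sub>R x}" and f: "finite C"
  have "card C = (\<Sum>c\<in>C. 1)" by simp
  also have "\<dots> \<le> (\<Sum>c\<in>C. dim {x \<in> V. M x = c *\<^sub>R x})"
  proof (rule sum_mono)
    fix c assume "c \<in> C"
    then have "dim {x \<in> V. M x = c *\<^sub>R x} \<noteq> 0" using C by (auto simp: subset_iff)
    then show "1 \<le> dim {x \<in> V. M x = c *\<^sub>R x}"
      by (simp only: One_nat_def Suc_le_eq neq0_conv)
  qed
  also have "\<dots> \<le> DIM('a)" unfolding dim_span_eigenspaces[OF M V f, symmetric] by (rule dim_subset_UNIV)
  finally show "card C \<le> DIM('a)" .
qed

section \<open>Metric two-step nilpotent Lie algebras with one-dimensional centre\<close>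

text \<open>The vector \<open>e\<close> spans the centre but is not normalised, hence the quotients
  by \<open>B e e\<close>. It becomes \<open>z0\<close> itself when \<open>z0\<close> is nonzero,
  and the unit vector \<open>z\<close> when \<open>z0 = 0\<close>.\<close>

locale metric_two_step =
  fixes br :: "'n::euclidean_space \<Rightarrow> 'n \<Rightarrow> 'n" and B :: "'n \<Rightarrow> 'n \<Rightarrow> real" and e :: 'n
  assumes nil: "two_step_nilpotent br"
    and ip: "inner_product B"
    and znd: "\<forall>x\<in>center br. (\<forall>y\<in>center br. B x y = 0) \<longrightarrow> x = 0"
    and dimz: "dim (center br) = 1"
    and e: "e \<in> center br" "e \<noteq> 0"
begin

abbreviation "Z \<equiv> center br"
abbreviation "V \<equiv> vpart br B"
abbreviation "L \<equiv> Jop br B e"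

lemma bilinear_br: "bilinear br" and bilinear_B: "bilinear B"
  using nil ip unfolding two_step_nilpotent_def inner_product_def by blast+

lemmas bounded_bilinear_B = bilinear_B[unfolded bilinear_conv_bounded_bilinear]

lemmas br_simps = bilinear_ladd[OF bilinear_br] bilinear_radd[OF bilinear_br] bilinear_lmul[OF bilinear_br]
  bilinear_rmul[OF bilinear_br] bilinear_lsub[OF bilinear_br] bilinear_rsub[OF bilinear_br]
  bilinear_lzero[OF bilinear_br] bilinear_rzero[OF bilinear_br] bilinear_lneg[OF bilinear_br] bilinear_rneg[OF bilinear_br]

lemmas B_simps = bilinear_ladd[OF bilinear_B] bilinear_radd[OF bilinear_B] bilinear_lmul[OF bilinear_B]
  bilinear_rmul[OF bilinear_B] bilinear_lsub[OF bilinear_B] bilinear_rsub[OF bilinear_B]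
  bilinear_lzero[OF bilinear_B] bilinear_rzero[OF bilinear_B] bilinear_lneg[OF bilinear_B] bilinear_rneg[OF bilinear_B]

lemma br_anti: "br x y = - br y x"
  using nil unfolding two_step_nilpotent_def by blast

lemma B_sym: "B x y = B y x"
  using ip by (simp add: inner_product_def)

lemma B_nondegenerate: "(\<And>y. B x y = 0) \<Longrightarrow> x = 0"
  using ip by (simp add: inner_product_def)

lemma B_eqI: "(\<And>w. B x w = B y w) \<Longrightarrow> x = y"
  using B_nondegenerate[of "x - y"] by (simp add: B_simps)

text \<open>The map \<open>\<phi>\<close> sends \<open>y\<close> to the Euclidean vector of the
  functional \<open>B y\<close>; nondegeneracy makes it injective, hence surjective by
  dimension.\<close>

lemma B_representation:
  fixes f :: "'n \<Rightarrow> real"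
  assumes f: "linear f"
  obtains y where "\<And>w. B y w = f w"
proof -
  define \<phi> where "\<phi> y = (\<Sum>b\<in>Basis. B y b *\<^sub>R b)" for y
  have \<phi>b: "\<phi> y \<bullet> b = B y b" if "b \<in> Basis" for y b
    using that by (simp add: \<phi>_def inner_sum_left_Basis)
  have lin: "linear \<phi>"
    by (rule linearI) (simp_all add: \<phi>_def B_simps scaleR_add_left sum.distrib scaleR_sum_right)
  have ext: "B y = g" if "linear g" "\<And>b. b \<in> Basis \<Longrightarrow> B y b = g b" for y g
    using that bilinear_B by (intro linear_eq_stdbasis) (auto simp: bilinear_def)
  have "inj \<phi>"
    unfolding linear_injective_0[OF lin]
  proof safe
    fix y assume "\<phi> y = 0"
    then have "B y = (\<lambda>_. 0)" using \<phi>b[of _ y] by (intro ext linear_zero) auto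
    then show "y = 0" by (intro B_nondegenerate) auto
  qed
  then obtain y where "(\<Sum>b\<in>Basis. f b *\<^sub>R b) = \<phi> y"
    using linear_injective_imp_surjective[OF lin] by (metis surjD)
  then have "B y b = f b" if "b \<in> Basis" for b
    using \<phi>b[OF that, of y] that by (metis inner_sum_left_Basis)
  then show thesis using ext[OF f] that by metis
qed

lemma subspace_V: "subspace V"
  by (auto simp: vpart_def subspace_def B_simps)

lemma subspace_Z: "subspace Z"
  by (auto simp: center_def subspace_def br_simps)

lemma Z_iff: "x \<in> Z \<longleftrightarrow> (\<exists>c. x = c *\<^sub>R e)"
proof -
  have "e \<notin> span {}" using e by (simp add: span_empty)
  then have d: "dim (span {e}) = 1" by (simp only: dim_span dim_insert if_False dim_empty)
  have "span {e} = Z"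
  proof (rule subspace_dim_equal[OF subspace_span subspace_Z])
    show "span {e} \<subseteq> Z" using e by (intro span_minimal subspace_Z) simp
    show "dim Z \<le> dim (span {e})" unfolding d dimz ..
  qed
  then show ?thesis by (auto simp: span_singleton)
qed

lemma Bee: "B e e \<noteq> 0"
proof
  assume "B e e = 0"
  then have "\<forall>y\<in>Z. B e y = 0" by (auto simp: Z_iff B_simps)
  then show False using znd e by blast
qed

lemma V_iff: "x \<in> V \<longleftrightarrow> B e x = 0"
  using e by (auto simp: vpart_def Z_iff B_simps)

lemma br_center [simp]: "br (c *\<^sub>R e) x = 0" "br x (c *\<^sub>R e) = 0" "br e x = 0" "br x e = 0"
  using e br_anti[of x e] by (simp_all add: center_def br_simps)

lemma br_eq: "br x y = (B e (br x y) / B e e) *\<^sub>R e"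
proof -
  have "br x y \<in> Z" using nil unfolding two_step_nilpotent_def center_def by blast
  then show ?thesis using Bee by (auto simp: Z_iff B_simps)
qed

lemma V_part: "x - (B e x / B e e) *\<^sub>R e \<in> V"
  using Bee by (simp add: V_iff B_simps)

lemma V_nondegenerate:
  assumes "x \<in> V" "\<And>w. w \<in> V \<Longrightarrow> B x w = 0"
  shows "x = 0"
proof (rule B_nondegenerate)
  fix w
  have "B x (w - (B e w / B e e) *\<^sub>R e) = 0" by (intro assms V_part)
  then show "B x w = 0" using assms(1) by (simp add: B_simps V_iff B_sym[of x])
qed

text \<open>Justifies the \<open>THE\<close> in \<open>Jop\<close>. The vector representing the
  functional on the whole algebra lies in \<open>V\<close> because \<open>br x e = 0\<close>, so the
  defining identity holds against every \<open>w\<close>, and for arbitrary \<open>z\<close> and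
  \<open>x\<close>.\<close>

lemma Jop_char: "Jop br B z x \<in> V" "B (Jop br B z x) w = B z (br x w)"
proof -
  have "linear (\<lambda>w. B z (br x w))" by (rule linearI) (simp_all add: B_simps br_simps)
  then obtain y where y: "\<And>w. B y w = B z (br x w)" using B_representation by blast
  have yV: "y \<in> V" using y[of e] by (simp add: V_iff B_sym[of e] B_simps)
  have "Jop br B z x = y"
    unfolding Jop_def
  proof (rule the_equality)
    fix y' assume y': "y' \<in> V \<and> (\<forall>w\<in>V. B y' w = B z (br x w))"
    have "y' - y = 0"
      by (rule V_nondegenerate) (use y' y yV in \<open>auto simp: B_simps subspace_diff[OF subspace_V]\<close>)
    then show "y' = y" by simp
  qed (use y yV in auto)
  then show "Jop br B z x \<in> V" "B (Jop br B z x) w = B z (br x w)" using y yV by auto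
qed

text \<open>Brackets see only the component of \<open>z\<close> along \<open>e\<close>. This is
  where the one-dimensional centre enters: all these operators are multiples of the single operator
  \<open>L\<close>.\<close>

lemma Jop_eq: "Jop br B z x = (B e z / B e e) *\<^sub>R L x"
proof (rule B_eqI)
  fix w
  have "B z (br x w) = (B e (br x w) / B e e) * B z e" by (subst br_eq) (simp add: B_simps)
  then show "B (Jop br B z x) w = B ((B e z / B e e) *\<^sub>R L x) w"
    by (simp add: Jop_char B_simps B_sym[of z e])
qed

lemma L_V [simp]: "L x \<in> V" and B_L: "B (L x) w = B e (br x w)"
  by (rule Jop_char)+

lemma linear_L: "linear L"
  by (rule linearI) (rule B_eqI, simp add: B_L B_simps br_simps)+

lemmas L_simps = linear_add[OF linear_L] linear_diff[OF linear_L] linear_scale[OF linear_L] linear_0[OF linear_L]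

lemma L_e [simp]: "L e = 0"
  by (rule B_eqI) (simp add: B_L B_simps)

lemma B_e_L [simp]: "B e (L x) = 0" "B (L x) e = 0"
  using L_V[of x] by (simp_all add: V_iff B_sym[of _ e])

lemma L_skew: "B (L x) y = - B x (L y)"
  using br_anti[of x y] by (simp add: B_L B_sym[of x] B_simps)

lemma B_nabla: "B (nabla br B X Y) W = (B (br X Y) W - B (br Y W) X + B (br W X) Y) / 2"
proof -
  have "linear (\<lambda>W. (B (br X Y) W - B (br Y W) X + B (br W X) Y) / 2)"
    by (rule linearI) (simp_all add: B_simps br_simps field_simps)
  then obtain y where y: "\<And>W. B y W = (B (br X Y) W - B (br Y W) X + B (br W X) Y) / 2"
    using B_representation by blast
  have "nabla br B X Y = y"
    unfolding nabla_def by (rule the_equality) (auto simp: y intro: B_eqI)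
  then show ?thesis using y by simp
qed

lemma bilinear_nabla: "bilinear (nabla br B)"
  unfolding bilinear_def
  by (intro conjI allI; rule linearI; rule B_eqI) (simp_all add: B_nabla B_simps br_simps field_simps)

lemmas bounded_bilinear_nabla = bilinear_nabla[unfolded bilinear_conv_bounded_bilinear]
lemmas nabla_simps = bilinear_ladd[OF bilinear_nabla] bilinear_radd[OF bilinear_nabla]
   bilinear_lneg[OF bilinear_nabla] bilinear_rneg[OF bilinear_nabla]

lemma nabla_torsion_free: "nabla br B X Y = br X Y + nabla br B Y X"
proof (rule B_eqI)
  fix W
  show "B (nabla br B X Y) W = B (br X Y + nabla br B Y X) W"
    using br_anti[of Y X] br_anti[of W X] br_anti[of W Y] by (simp add: B_nabla B_simps field_simps)
qed

text \<open>\<open>Jop br B X Y\<close> is the \<open>B\<close>-transpose of ad \<open>Y\<close>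
  applied to \<open>X\<close>, so the right side is the polarised Euler-Arnold term.\<close>

lemma nabla_symmetric_part: "nabla br B X Y + nabla br B Y X = - (Jop br B X Y + Jop br B Y X)"
proof (rule B_eqI)
  fix W
  show "B (nabla br B X Y + nabla br B Y X) W = B (- (Jop br B X Y + Jop br B Y X)) W"
    using br_anti[of Y X] br_anti[of W X] br_anti[of W Y]
    by (simp add: B_nabla B_simps Jop_char B_sym[of X] B_sym[of Y] field_simps)
qed

end

section \<open>Jacobi fields\<close>

text \<open>The generator \<open>e\<close> of the centre is a parameter, and \<open>z0 = a e\<close>: this also covers
  \<open>z0 = 0\<close>, where the theorem refers to a unit central vector.\<close>

locale metric_two_step_geodesic = metric_two_step +
  fixes a :: real and x0 :: 'a
  assumes x0: "x0 \<in> V"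
begin

abbreviation "J \<equiv> Jop br B (a *\<^sub>R e)"
abbreviation "E \<equiv> expT J"
abbreviation "\<xi> \<equiv> gvel br B (a *\<^sub>R e) x0"

lemma J_eq: "J x = a *\<^sub>R L x"
proof -
  have "B e (a *\<^sub>R e) / B e e = a" using Bee by (simp add: B_simps)
  then show ?thesis using Jop_eq[of "a *\<^sub>R e" x] by (simp only:)
qed

lemma linear_J: "linear J"
proof -
  have "J = (\<lambda>x. a *\<^sub>R L x)" by (rule ext) (rule J_eq)
  then show ?thesis using linear_compose_scale_right[OF linear_L, of a] by (simp only:)
qed

lemma J_V [simp]: "J x \<in> V"
  by (rule Jop_char)

lemma E_V [simp]: "x \<in> V \<Longrightarrow> E s x \<in> V"
  by (rule expT_in_subspace[OF linear_J subspace_V]) auto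

lemma E_deriv: "((\<lambda>s. E s x) has_vector_derivative a *\<^sub>R L (E s x)) (at s)"
  using has_vector_derivative_expT[OF linear_J] by (simp add: J_eq)

lemma L_E: "L (E s x) = E s (L x)"
  by (rule expT_commute[OF linear_J linear_L]) (simp add: J_eq L_simps)

lemmas E_simps = linear_add[OF linear_expT[OF linear_J]] linear_diff[OF linear_expT[OF linear_J]]
  linear_scale[OF linear_expT[OF linear_J]] linear_0[OF linear_expT[OF linear_J]]

lemma E_e [simp]: "E s e = e"
  by (rule expT_unique[OF linear_J, of "\<lambda>_. e", symmetric]) (simp add: J_eq)

lemma B_E: "B (E s x) (E s y) = B x y"
proof -
  have "((\<lambda>s. B (E s x) (E s y)) has_vector_derivative 0) (at s)" for s
    by (rule has_vector_derivative_eq_rhs[OF bounded_bilinear.has_vector_derivative[OF bounded_bilinear_B E_deriv E_deriv]])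
       (simp add: B_simps L_skew)
  then show ?thesis
    using has_vector_derivative_unique_at_0[of "\<lambda>s. B (E s x) (E s y)" "\<lambda>_. 0" "\<lambda>_. B x y" s] by simp
qed

lemma B_e_E [simp]: "B e (E s x) = B e x"
  using B_E[of s e x] by simp

lemma gvel_eq: "\<xi> s = a *\<^sub>R e + E s x0"
  by (simp add: gvel_def expJ_def expT_def)

lemma B_e_x0 [simp]: "B e x0 = 0"
  using x0 by (simp add: V_iff)

lemma Jop_gvel: "Jop br B (\<xi> s) y = a *\<^sub>R L y"
  using Bee by (subst Jop_eq) (simp add: gvel_eq B_simps)

lemma L_gvel: "L (\<xi> s) = L (E s x0)"
  by (simp add: gvel_eq L_simps)

lemma br_gvel: "br (\<xi> s) y = br (E s x0) y"
  by (simp add: gvel_eq br_simps)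

text \<open>The geodesic equation in the left trivialisation; the Jacobi equation needs it to
  differentiate \<open>nabla\<close> in the direction of the velocity.\<close>

lemma gvel_deriv: "(\<xi> has_vector_derivative - nabla br B (\<xi> s) (\<xi> s)) (at s)"
proof -
  have "2 *\<^sub>R nabla br B (\<xi> s) (\<xi> s) = 2 *\<^sub>R (- (a *\<^sub>R L (\<xi> s)))"
    using nabla_symmetric_part[of "\<xi> s" "\<xi> s"] by (simp only: Jop_gvel scaleR_2 minus_add_distrib)
  then have "nabla br B (\<xi> s) (\<xi> s) = - (a *\<^sub>R L (\<xi> s))"
    by (metis scaleR_cancel_left zero_neq_numeral)
  then have "- nabla br B (\<xi> s) (\<xi> s) = a *\<^sub>R L (E s x0)"
    by (simp add: L_gvel)
  moreover have "((\<lambda>s. a *\<^sub>R e + E s x0) has_vector_derivative a *\<^sub>R L (E s x0)) (at s)"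
    by (auto intro!: derivative_eq_intros E_deriv)
  ultimately show ?thesis by (simp add: gvel_eq[abs_def])
qed

text \<open>As the connection is torsion free, the Jacobi equation is equivalent to the linearised
  Euler-Arnold equation for the variation \<open>W = Y' + [\<gamma>', Y]\<close> of the body velocity.\<close>

lemma jacobi_field_iff_variation:
  "jacobi_field br B (a *\<^sub>R e) x0 Y \<longleftrightarrow>
    (\<exists>Y1. (\<forall>t. (Y has_vector_derivative Y1 t) (at t)) \<and>
      (\<forall>t. ((\<lambda>s. Y1 s + br (\<xi> s) (Y s)) has_vector_derivative
         a *\<^sub>R L (Y1 t + br (\<xi> t) (Y t)) + (B e (Y1 t + br (\<xi> t) (Y t)) / B e e) *\<^sub>R L (E t x0)) (at t)))"
proof -
  let ?N = "nabla br B"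
  have key: "(\<exists>Y2. (\<forall>t. ((\<lambda>s. Y1 s + ?N (\<xi> s) (Y s)) has_vector_derivative Y2 t) (at t)) \<and>
      (\<forall>t. Y2 t + ?N (\<xi> t) (Y1 t + ?N (\<xi> t) (Y t)) + curv br B (Y t) (\<xi> t) (\<xi> t) = 0)) \<longleftrightarrow>
     (\<forall>t. ((\<lambda>s. Y1 s + br (\<xi> s) (Y s)) has_vector_derivative
         a *\<^sub>R L (Y1 t + br (\<xi> t) (Y t)) + (B e (Y1 t + br (\<xi> t) (Y t)) / B e e) *\<^sub>R L (E t x0)) (at t))"
    if Y1: "\<And>t. (Y has_vector_derivative Y1 t) (at t)" for Y1
  proof -
    define W where "W s = Y1 s + br (\<xi> s) (Y s)" for s
    define N' where "N' t = ?N (Y t) (- ?N (\<xi> t) (\<xi> t)) + ?N (Y1 t) (\<xi> t)" for t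
    \<comment> \<open>By vanishing torsion, the covariant derivative of \<open>Y\<close> is
      \<open>W\<close> plus the derivative of \<xi> in the direction \<open>Y\<close>.\<close>
    have DY: "Y1 s + ?N (\<xi> s) (Y s) = W s + ?N (Y s) (\<xi> s)" for s
      using nabla_torsion_free[of "\<xi> s" "Y s"] by (simp add: W_def)
    have N': "((\<lambda>s. ?N (Y s) (\<xi> s)) has_vector_derivative N' t) (at t)" for t
      unfolding N'_def by (rule bounded_bilinear.has_vector_derivative[OF bounded_bilinear_nabla Y1 gvel_deriv])
    have WN: "((\<lambda>s. W s + ?N (Y s) (\<xi> s)) has_vector_derivative D + N' t) (at t) \<longleftrightarrow>
       (W has_vector_derivative D) (at t)" for D t
      using has_vector_derivative_add[OF _ N', of W D t]
        has_vector_derivative_diff[OF _ N', of "\<lambda>s. W s + ?N (Y s) (\<xi> s)" "D + N' t" t] by auto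
    \<comment> \<open>The two iterated terms of the curvature cancel, one against the first summand
      of \<open>N'\<close>, the other against \<open>?N (\<xi> t)\<close> applied to
      \<open>?N (Y t) (\<xi> t)\<close>. Its bracket term completes
      \<open>?N (Y1 t) (\<xi> t)\<close> to \<open>?N (W t) (\<xi> t)\<close>.\<close>
    have eq: "D + N' t + ?N (\<xi> t) (Y1 t + ?N (\<xi> t) (Y t)) + curv br B (Y t) (\<xi> t) (\<xi> t)
      = D + (?N (\<xi> t) (W t) + ?N (W t) (\<xi> t))" for D t
    proof -
      have "br (Y t) (\<xi> t) = - br (\<xi> t) (Y t)" by (rule br_anti)
      then show ?thesis
        unfolding DY curv_def N'_def by (simp add: nabla_simps W_def)
    qed
    have sym: "?N (\<xi> t) (W t) + ?N (W t) (\<xi> t) = - (a *\<^sub>R L (W t) + (B e (W t) / B e e) *\<^sub>R L (E t x0))" for t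
      unfolding nabla_symmetric_part Jop_gvel by (subst (2) Jop_eq) (simp add: L_gvel)
    have "(\<exists>Y2. (\<forall>t. ((\<lambda>s. Y1 s + ?N (\<xi> s) (Y s)) has_vector_derivative Y2 t) (at t)) \<and>
      (\<forall>t. Y2 t + ?N (\<xi> t) (Y1 t + ?N (\<xi> t) (Y t)) + curv br B (Y t) (\<xi> t) (\<xi> t) = 0)) \<longleftrightarrow>
      (\<exists>D. (\<forall>t. ((\<lambda>s. Y1 s + ?N (\<xi> s) (Y s)) has_vector_derivative D t + N' t) (at t)) \<and>
      (\<forall>t. (D t + N' t) + ?N (\<xi> t) (Y1 t + ?N (\<xi> t) (Y t)) + curv br B (Y t) (\<xi> t) (\<xi> t) = 0))"
      (is "(\<exists>Y2. ?P Y2) \<longleftrightarrow> (\<exists>D. ?P (\<lambda>t. D t + N' t))")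
    proof
      assume "\<exists>Y2. ?P Y2"
      then obtain Y2 where "?P Y2" by blast
      then have "?P (\<lambda>t. (Y2 t - N' t) + N' t)" by simp
      then show "\<exists>D. ?P (\<lambda>t. D t + N' t)" by (rule exI[of _ "\<lambda>t. Y2 t - N' t"])
    next
      assume "\<exists>D. ?P (\<lambda>t. D t + N' t)"
      then obtain D where "?P (\<lambda>t. D t + N' t)" by blast
      then show "\<exists>Y2. ?P Y2" by (rule exI[of _ "\<lambda>t. D t + N' t"])
    qed
    also have "\<dots> \<longleftrightarrow> (\<exists>D. (\<forall>t. (W has_vector_derivative D t) (at t)) \<and>
       (\<forall>t. D t = a *\<^sub>R L (W t) + (B e (W t) / B e e) *\<^sub>R L (E t x0)))"
      unfolding eq unfolding DY WN sym add_uminus_conv_diff right_minus_eq ..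
    also have "\<dots> \<longleftrightarrow> (\<forall>t. (W has_vector_derivative a *\<^sub>R L (W t) + (B e (W t) / B e e) *\<^sub>R L (E t x0)) (at t))"
      (is "_ \<longleftrightarrow> (\<forall>t. (W has_vector_derivative ?F t) (at t))")
    proof
      assume "\<forall>t. (W has_vector_derivative ?F t) (at t)"
      then show "\<exists>D. (\<forall>t. (W has_vector_derivative D t) (at t)) \<and> (\<forall>t. D t = ?F t)"
        by (intro exI[of _ ?F]) simp
    qed auto
    finally show ?thesis by (simp add: W_def[abs_def])
  qed
  show ?thesis
    unfolding jacobi_field_def using key by blast
qed

section \<open>Closed form of the Jacobi fields vanishing at 0\<close>

definition zcoord :: "'a \<Rightarrow> real" where "zcoord p = B e p / B e e"

text \<open>The \<open>V\<close> part of the field: the bracket with the velocity is central, so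
  this is the plain integral of the \<open>V\<close> part of \<open>W\<close>.\<close>

definition solv :: "'a \<Rightarrow> real \<Rightarrow> 'a" where
  "solv p = prim (\<lambda>r. E r (p - zcoord p *\<^sub>R e) + (zcoord p * r) *\<^sub>R L (E r x0))"

text \<open>The central coefficient: the integrand is the constant coordinate of \<open>W\<close>
  less that of the bracket of \<open>E r x0\<close> with the \<open>V\<close> part already
  found.\<close>

definition solz :: "'a \<Rightarrow> real \<Rightarrow> real" where
  "solz p = prim (\<lambda>r. zcoord p - B (L (E r x0)) (solv p r) / B e e)"

text \<open>The Jacobi field with Y(0) = 0 and Y'(0) = p.\<close>
definition sol :: "'a \<Rightarrow> real \<Rightarrow> 'a" where
  "sol p s = solv p s + solz p s *\<^sub>R e"

text \<open>The Jacobi equation integrated once, with the explicit \<open>W\<close> inserted; since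
  \<open>Y 0 = 0\<close>, the parameter is \<open>p = W 0 = Y' 0\<close>.\<close>

definition is_sol :: "'a \<Rightarrow> (real \<Rightarrow> 'a) \<Rightarrow> bool" where
  "is_sol p Y \<longleftrightarrow> Y 0 = 0 \<and> (\<forall>s. (Y has_vector_derivative
     E s p + (zcoord p * s) *\<^sub>R L (E s x0) - br (E s x0) (Y s)) (at s))"

lemma jacobi_field_iff_is_sol:
  "jacobi_field br B (a *\<^sub>R e) x0 Y \<and> Y 0 = 0 \<longleftrightarrow> (\<exists>p. is_sol p Y)"
proof safe
  assume "jacobi_field br B (a *\<^sub>R e) x0 Y" and Y0: "Y 0 = 0"
  then obtain Y1 where Y1: "\<And>t. (Y has_vector_derivative Y1 t) (at t)"
    and W1: "\<And>t. ((\<lambda>s. Y1 s + br (\<xi> s) (Y s)) has_vector_derivative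
         a *\<^sub>R L (Y1 t + br (\<xi> t) (Y t)) + (B e (Y1 t + br (\<xi> t) (Y t)) / B e e) *\<^sub>R L (E t x0)) (at t)"
    unfolding jacobi_field_iff_variation by blast
  define W where "W s = Y1 s + br (\<xi> s) (Y s)" for s
  have W: "(W has_vector_derivative a *\<^sub>R L (W t) + (B e (W t) / B e e) *\<^sub>R L (E t x0)) (at t)" for t
    using W1 by (simp add: W_def[abs_def])
  define p where "p = W 0"
  \<comment> \<open>The image of \<open>L\<close> is orthogonal to \<open>e\<close>, so the central
    coordinate of \<open>W\<close> is conserved.\<close>
  have "((\<lambda>s. B e (W s)) has_vector_derivative 0) (at t)" for t
    by (rule has_vector_derivative_eq_rhs[OF bounded_linear.has_vector_derivative[OF
          bounded_bilinear.bounded_linear_right[OF bounded_bilinear_B] W]]) (simp add: B_simps)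
  then have "B e (W t) = B e p" for t
    by (rule has_vector_derivative_unique_at_0[where h = "\<lambda>_. 0"]) (simp_all add: p_def)
  then have c: "B e (W t) / B e e = zcoord p" for t unfolding zcoord_def by (rule arg_cong)
  \<comment> \<open>Since \<open>L\<close> commutes with the flow, the forcing
    \<open>c L (E t x0)\<close> has the particular solution \<open>c t L (E t x0)\<close>; the rest
    solves the homogeneous equation.\<close>
  have "W t - (zcoord p * t) *\<^sub>R L (E t x0) = E t p" for t
  proof -
    have "((\<lambda>t. W t - (zcoord p * t) *\<^sub>R E t (L x0)) has_vector_derivative J (W t - (zcoord p * t) *\<^sub>R E t (L x0))) (at t)" for t
      using W[of t] unfolding c
      by (auto intro!: derivative_eq_intros E_deriv simp: J_eq L_simps L_E algebra_simps)
    from expT_unique[OF linear_J this, of t] show ?thesis by (simp add: p_def L_E)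
  qed
  then have "Y1 t = E t p + (zcoord p * t) *\<^sub>R L (E t x0) - br (E t x0) (Y t)" for t
    unfolding br_gvel[symmetric] by (simp add: W_def algebra_simps)
  then have "is_sol p Y" using Y1 Y0 by (simp add: is_sol_def)
  then show "\<exists>p. is_sol p Y" ..
next
  fix p assume Y: "is_sol p Y"
  define Y1 where "Y1 s = E s p + (zcoord p * s) *\<^sub>R L (E s x0) - br (E s x0) (Y s)" for s
  have W: "Y1 s + br (\<xi> s) (Y s) = E s p + (zcoord p * s) *\<^sub>R E s (L x0)" for s
    by (simp add: Y1_def br_gvel L_E)
  have "B e (E s p + (zcoord p * s) *\<^sub>R E s (L x0)) / B e e = zcoord p" for s
    by (simp add: B_simps zcoord_def)
  then show "jacobi_field br B (a *\<^sub>R e) x0 Y"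
    unfolding jacobi_field_iff_variation
    by (intro exI[of _ Y1], unfold W)
       (use Y in \<open>auto simp: is_sol_def Y1_def L_E L_simps algebra_simps intro!: derivative_eq_intros E_deriv\<close>)
  show "Y 0 = 0" using Y by (simp add: is_sol_def)
qed

end

text \<open>\<open>mult_cp\<close> measures dimension among all curves, an infinite-dimensional
  space; an injective linear parametrisation by initial velocities transfers it to
  \<open>dim\<close>.\<close>

lemma dim_image_function_space:
  fixes F :: "'a::euclidean_space \<Rightarrow> real \<Rightarrow> 'b::real_vector"
  assumes add: "\<And>x y. F (x + y) = (\<lambda>s. F x s + F y s)" and scale: "\<And>c x. F (c *\<^sub>R x) = (\<lambda>s. c *\<^sub>R F x s)"
    and inj: "\<And>x. F x = (\<lambda>_. 0) \<Longrightarrow> x = 0"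
  shows "vector_space.dim (\<lambda>r f s. r *\<^sub>R f s) (F ` S) = dim S"
proof -
  have vs: "vector_space (\<lambda>(r::real) (f::real \<Rightarrow> 'b) s. r *\<^sub>R f s)"
    by unfold_locales (auto simp: fun_eq_iff algebra_simps)
  interpret p: finite_dimensional_vector_space_pair_1 "scaleR :: real \<Rightarrow> 'a \<Rightarrow> 'a" Basis
    "\<lambda>(r::real) (f::real \<Rightarrow> 'b) s. r *\<^sub>R f s"
    by (intro finite_dimensional_vector_space_pair_1.intro finite_dimensional_vector_space_euclidean vs)
  have "Vector_Spaces.linear (*\<^sub>R) (\<lambda>(r::real) (f::real \<Rightarrow> 'b) s. r *\<^sub>R f s) F"
    by unfold_locales (auto simp: add scale fun_eq_iff)
  moreover have "inj F"
  proof (rule injI)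
    fix x y assume "F x = F y"
    then have "F (x + (- 1) *\<^sub>R y) = (\<lambda>_. 0)" by (simp only: add scale) (simp add: fun_eq_iff)
    then have "x + (- 1) *\<^sub>R y = 0" by (rule inj)
    then show "x = y" by simp
  qed
  ultimately show ?thesis
    using p.dim_image_eq[of F S] inj_on_subset[of F UNIV] by (simp add: dim_raw_def)
qed

lemma linear_injective_on_imp_surjective_on:
  fixes f :: "'a::euclidean_space \<Rightarrow> 'a"
  assumes f: "linear f" and S: "subspace S" and fS: "\<And>x. x \<in> S \<Longrightarrow> f x \<in> S"
    and inj: "\<And>x. x \<in> S \<Longrightarrow> f x = 0 \<Longrightarrow> x = 0" and y: "y \<in> S"
  obtains x where "x \<in> S" "f x = y"
proof -
  have "inj_on f (span S)"
    using linear_injective_on_subspace_0[OF f S] inj S by (simp add: span_eq_iff[THEN iffD2])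
  then have "dim (f ` S) = dim S" by (rule eucl.dim_image_eq[OF f])
  then have "f ` S = S" using fS by (intro subspace_dim_equal linear_subspace_image f S) auto
  then show thesis using y that by (metis imageE)
qed

context metric_two_step_geodesic
begin

lemma zcoord_add: "zcoord (p + q) = zcoord p + zcoord q" and zcoord_scale: "zcoord (k *\<^sub>R p) = k * zcoord p"
  by (simp_all add: zcoord_def B_simps add_divide_distrib)

lemma zcoord_V: "p - zcoord p *\<^sub>R e \<in> V"
  by (simp add: zcoord_def V_part)

lemma zcoord_V_zero: "p \<in> V \<Longrightarrow> zcoord p = 0"
  by (simp add: zcoord_def V_iff)

lemma zcoord_e [simp]: "zcoord e = 1"
  using Bee by (simp add: zcoord_def)

lemma continuous_on_E: "continuous_on UNIV (\<lambda>r. E r x)"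
  by (rule continuous_on_expT[OF linear_J])

lemma continuous_solv_integrand:
  "continuous_on UNIV (\<lambda>r. E r (p - zcoord p *\<^sub>R e) + (zcoord p * r) *\<^sub>R L (E r x0))"
  unfolding L_E by (intro continuous_intros continuous_on_E)

lemma solv_deriv: "(solv p has_vector_derivative E s (p - zcoord p *\<^sub>R e) + (zcoord p * s) *\<^sub>R L (E s x0)) (at s)"
  unfolding solv_def by (rule has_vector_derivative_prim[OF continuous_solv_integrand])

lemma solv_0 [simp]: "solv p 0 = 0"
  by (simp add: solv_def)

lemma B_e_solv [simp]: "B e (solv p s) = 0"
proof (rule has_vector_derivative_unique_at_0[where f = "\<lambda>s. B e (solv p s)" and g = "\<lambda>_. 0" and h = "\<lambda>_. 0"])
  fix t
  have "B e (p - zcoord p *\<^sub>R e) = 0" using zcoord_V by (simp add: V_iff)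
  then show "((\<lambda>s. B e (solv p s)) has_vector_derivative 0) (at t)"
    by (intro has_vector_derivative_eq_rhs[OF bounded_linear.has_vector_derivative[OF
          bounded_bilinear.bounded_linear_right[OF bounded_bilinear_B] solv_deriv]]) (simp add: B_simps)
qed (auto simp: B_simps)

lemma solz_deriv: "(solz p has_vector_derivative zcoord p - B (L (E s x0)) (solv p s) / B e e) (at s)"
  unfolding solz_def
proof (rule has_vector_derivative_prim)
  have "continuous_on UNIV (\<lambda>r. B (E r (L x0)) (solv p r))"
    using has_vector_derivative_imp_continuous_on[OF solv_deriv]
    by (intro bounded_bilinear.continuous_on[OF bounded_bilinear_B] continuous_on_E)
  then show "continuous_on UNIV (\<lambda>r. zcoord p - B (L (E r x0)) (solv p r) / B e e)"
    unfolding L_E using Bee by (intro continuous_intros) auto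
qed

lemma solz_0 [simp]: "solz p 0 = 0"
  by (simp add: solz_def)

lemma is_sol_sol: "is_sol p (sol p)"
proof -
  have "(sol p has_vector_derivative E s p + (zcoord p * s) *\<^sub>R L (E s x0) - br (E s x0) (sol p s)) (at s)" for s
  proof -
    have "br (E s x0) (sol p s) = (B (L (E s x0)) (solv p s) / B e e) *\<^sub>R e"
      by (subst br_eq) (simp add: B_L[symmetric] sol_def B_simps)
    moreover have "((\<lambda>s. solv p s + solz p s *\<^sub>R e) has_vector_derivative
      E s (p - zcoord p *\<^sub>R e) + (zcoord p * s) *\<^sub>R L (E s x0) + (zcoord p - B (L (E s x0)) (solv p s) / B e e) *\<^sub>R e) (at s)"
      by (auto intro!: derivative_eq_intros solv_deriv solz_deriv simp: has_real_derivative_iff_has_vector_derivative)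
    ultimately show ?thesis
      by (simp add: sol_def[abs_def] E_simps algebra_simps)
  qed
  then show ?thesis by (simp add: is_sol_def sol_def)
qed

text \<open>The difference \<open>D\<close> of two solutions satisfies
  \<open>D' = - br (E s x0) D\<close>, whose right side is central. Hence the \<open>V\<close> part
  of \<open>D\<close> stays 0, so \<open>D\<close> is central, the bracket vanishes and
  \<open>D\<close> is constant.\<close>

lemma is_sol_unique:
  assumes Y: "is_sol p Y" and X: "is_sol p X"
  shows "Y = X"
proof -
  have D: "((\<lambda>s. Y s - X s) has_vector_derivative - br (E s x0) (Y s - X s)) (at s)" for s
    using has_vector_derivative_diff[of Y _ "at s" X] Y X unfolding is_sol_def
    by (auto intro!: derivative_eq_intros simp: br_simps)
  have V0: "B w (Y s - X s) = 0" if "w \<in> V" for w s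
  proof (rule has_vector_derivative_unique_at_0[where f = "\<lambda>s. B w (Y s - X s)" and g = "\<lambda>_. 0" and h = "\<lambda>_. 0"])
    fix t
    show "((\<lambda>s. B w (Y s - X s)) has_vector_derivative 0) (at t)"
      by (rule has_vector_derivative_eq_rhs[OF bounded_linear.has_vector_derivative[OF
          bounded_bilinear.bounded_linear_right[OF bounded_bilinear_B] D]], subst br_eq)
         (use that in \<open>simp add: B_simps V_iff B_sym[of w e]\<close>)
  qed (use Y X in \<open>auto simp: is_sol_def B_simps\<close>)
  have Z0: "Y s - X s = (B e (Y s - X s) / B e e) *\<^sub>R e" for s
  proof -
    have "(Y s - X s) - (B e (Y s - X s) / B e e) *\<^sub>R e = 0"
    proof (rule V_nondegenerate[OF V_part])
      fix w assume w: "w \<in> V"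
      have "B w (Y s - X s - (B e (Y s - X s) / B e e) *\<^sub>R e) = 0"
        using V0[OF w, of s] w by (simp add: B_simps V_iff B_sym[of w e])
      then show "B (Y s - X s - (B e (Y s - X s) / B e e) *\<^sub>R e) w = 0" by (subst B_sym)
    qed
    then show ?thesis by simp
  qed
  have "br x (Y s - X s) = 0" for x s by (subst Z0) simp
  then have "((\<lambda>s. Y s - X s) has_vector_derivative 0) (at s)" for s using D[of s] by simp
  then have "Y s - X s = 0" for s
    by (rule has_vector_derivative_unique_at_0[where f = "\<lambda>s. Y s - X s" and g = "\<lambda>_. 0" and h = "\<lambda>_. 0"]) (use Y X in \<open>auto simp: is_sol_def\<close>)
  then show ?thesis by auto
qed

lemma sol_add: "sol (p + q) = (\<lambda>s. sol p s + sol q s)"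
proof (rule is_sol_unique[OF is_sol_sol])
  show "is_sol (p + q) (\<lambda>s. sol p s + sol q s)"
    using is_sol_sol[of p] is_sol_sol[of q] unfolding is_sol_def
    by (auto intro!: derivative_eq_intros simp: E_simps br_simps zcoord_add algebra_simps)
qed

lemma sol_scale: "sol (k *\<^sub>R p) = (\<lambda>s. k *\<^sub>R sol p s)"
proof (rule is_sol_unique[OF is_sol_sol])
  show "is_sol (k *\<^sub>R p) (\<lambda>s. k *\<^sub>R sol p s)"
    using is_sol_sol[of p] unfolding is_sol_def
    by (auto intro!: derivative_eq_intros simp: E_simps br_simps zcoord_scale algebra_simps)
qed

lemma sol_eq_0_imp: 
  assumes "sol p = (\<lambda>_. 0)"
  shows "p = 0"
proof -
  have "((\<lambda>_. 0) has_vector_derivative p) (at 0)"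
    using is_sol_sol[of p] unfolding is_sol_def assms by (auto simp: br_simps dest: spec[of _ 0])
  then show ?thesis
    using has_vector_derivative_const vector_derivative_unique_at by blast
qed

lemma sol_eq_0_iff: "sol p = (\<lambda>_. 0) \<longleftrightarrow> p = 0"
proof
  assume "p = 0"
  then show "sol p = (\<lambda>_. 0)" using sol_scale[of 0 0] by simp
qed (rule sol_eq_0_imp)

lemma jacobi_vanishing_iff: 
  "jacobi_field br B (a *\<^sub>R e) x0 Y \<and> Y 0 = 0 \<longleftrightarrow> (\<exists>p. Y = sol p)"
  unfolding jacobi_field_iff_is_sol using is_sol_sol is_sol_unique by blast

lemma conjugate_iff:
  "conjugate br B (a *\<^sub>R e) x0 t \<longleftrightarrow> t \<noteq> 0 \<and> (\<exists>p. p \<noteq> 0 \<and> sol p t = 0)"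
proof -
  have "conjugate br B (a *\<^sub>R e) x0 t \<longleftrightarrow> t \<noteq> 0 \<and>
     (\<exists>Y. (jacobi_field br B (a *\<^sub>R e) x0 Y \<and> Y 0 = 0) \<and> Y \<noteq> (\<lambda>_. 0) \<and> Y t = 0)"
    unfolding conjugate_def by blast
  also have "\<dots> \<longleftrightarrow> t \<noteq> 0 \<and> (\<exists>p. sol p \<noteq> (\<lambda>_. 0) \<and> sol p t = 0)"
    unfolding jacobi_vanishing_iff by blast
  also have "\<dots> \<longleftrightarrow> t \<noteq> 0 \<and> (\<exists>p. p \<noteq> 0 \<and> sol p t = 0)"
    unfolding sol_eq_0_iff ..
  finally show ?thesis .
qed

lemma mult_cp_eq: "mult_cp br B (a *\<^sub>R e) x0 t = dim {p. sol p t = 0}"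
proof -
  have "{Y. jacobi_field br B (a *\<^sub>R e) x0 Y \<and> Y 0 = 0 \<and> Y t = 0} = sol ` {p. sol p t = 0}"
    unfolding conj_assoc[symmetric] jacobi_vanishing_iff by auto
  then show ?thesis
    unfolding mult_cp_def by (simp only: dim_image_function_space[of sol, OF sol_add sol_scale sol_eq_0_imp])
qed

lemma conjugate_iff_dim:
  "conjugate br B (a *\<^sub>R e) x0 t \<longleftrightarrow> t \<noteq> 0 \<and> dim {p. sol p t = 0} \<noteq> 0"
  unfolding conjugate_iff dim_eq_0 by blast

lemma sol_zero_iff: "sol p t = 0 \<longleftrightarrow> solv p t = 0 \<and> solz p t = 0"
proof
  assume *: "sol p t = 0"
  have "B e (sol p t) = solz p t * B e e" by (simp add: sol_def B_simps)
  then have "solz p t = 0" using * Bee by (simp add: B_simps)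
  then show "solv p t = 0 \<and> solz p t = 0" using * by (simp add: sol_def)
qed (simp add: sol_def)

section \<open>Conjugate points\<close>

text \<open>Formally \<open>E s - I\<close> divided by \<open>J\<close>, but meaningful for singular
  \<open>J\<close> as well.\<close>

definition Phi :: "real \<Rightarrow> 'a \<Rightarrow> 'a" where "Phi s u = prim (\<lambda>r. E r u) s"

lemma Phi_deriv: "((\<lambda>s. Phi s u) has_vector_derivative E s u) (at s)"
  unfolding Phi_def by (rule has_vector_derivative_prim[OF continuous_on_E])

lemma Phi_0 [simp]: "Phi 0 u = 0"
  by (simp add: Phi_def)

lemma PhiI: "(\<And>s. (g has_vector_derivative E s u) (at s)) \<Longrightarrow> g 0 = 0 \<Longrightarrow> Phi s u = g s"
  unfolding Phi_def by (rule fun_cong[OF prim_unique[OF continuous_on_E]])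

lemma linear_Phi: "linear (Phi s)"
  by (rule linearI; rule PhiI) (auto intro!: derivative_eq_intros Phi_deriv simp: E_simps)

lemmas Phi_simps = linear_add[OF linear_Phi] linear_diff[OF linear_Phi] linear_scale[OF linear_Phi] linear_0[OF linear_Phi]

lemma Phi_J: "Phi s (J u) = E s u - u"
proof (rule PhiI)
  fix s
  show "((\<lambda>s. E s u - u) has_vector_derivative E s (J u)) (at s)"
    using has_vector_derivative_expT[OF linear_J, of u s]
    by (simp only: has_vector_derivative_diff_const expT_commute[OF linear_J linear_J refl])
qed simp

lemma J_Phi: "J (Phi s u) = Phi s (J u)"
proof (rule PhiI[where g = "\<lambda>s. J (Phi s u)", symmetric])
  fix s
  have "((\<lambda>s. J (Phi s u)) has_vector_derivative J (E s u)) (at s)"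
    by (rule bounded_linear.has_vector_derivative[OF linear_J[unfolded linear_conv_bounded_linear] Phi_deriv])
  then show "((\<lambda>s. J (Phi s u)) has_vector_derivative E s (J u)) (at s)"
    by (simp only: expT_commute[OF linear_J linear_J refl])
qed (simp add: linear_0[OF linear_J])

lemma Phi_V: 
  assumes u: "u \<in> V"
  shows "Phi s u \<in> V"
proof -
  have "B e (Phi s u) = 0"
  proof (rule has_vector_derivative_unique_at_0[where f = "\<lambda>s. B e (Phi s u)" and g = "\<lambda>_. 0" and h = "\<lambda>_. 0"])
    fix t
    show "((\<lambda>s. B e (Phi s u)) has_vector_derivative 0) (at t)"
      by (rule has_vector_derivative_eq_rhs[OF bounded_linear.has_vector_derivative[OF
          bounded_bilinear.bounded_linear_right[OF bounded_bilinear_B] Phi_deriv]])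
         (use u in \<open>simp add: V_iff\<close>)
  qed (auto simp: B_simps)
  then show ?thesis by (simp add: V_iff)
qed

section \<open>The kernel of the integrated flow and the multiplicity sum\<close>

definition K :: "real \<Rightarrow> 'a set" where "K t = {u \<in> V. Phi t u = 0}"

abbreviation "\<Lambda> \<equiv> lambdas br B (a *\<^sub>R e)"

text \<open>At \<open>t = 2 pi n / l\<close> this is the index set of \<open>Ssum\<close>, described
  by \<open>t\<close> alone so that the choice of \<open>l\<close> and \<open>n\<close>
  disappears.\<close>

definition H :: "real \<Rightarrow> real set" where
  "H t = {h \<in> \<Lambda>. \<exists>m::int. m \<noteq> 0 \<and> h * t = 2 * pi * m}"

lemma subspace_K: "subspace (K t)"
  using subspace_V by (auto simp: K_def subspace_def Phi_simps)

lemma K_J: "u \<in> K t \<Longrightarrow> J u \<in> K t"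
  by (simp add: K_def J_Phi[symmetric] linear_0[OF linear_J])

lemma K_periodic: "u \<in> K t \<Longrightarrow> E t u = u"
  using Phi_J[of t u] K_J[of u t] by (simp add: K_def)

lemma linear_JJ: "linear (\<lambda>x. J (J x))"
  using linear_compose[OF linear_J linear_J] by (simp add: o_def)

text \<open>On such a vector the flow is a rotation of frequency \<open>h\<close>, whose integral
  vanishes after full turns.\<close>

lemma eigenspace_subset_K:
  assumes t: "t \<noteq> 0" and h: "h \<in> H t" and x: "x \<in> V" "J (J x) = - (h\<^sup>2) *\<^sub>R x"
  shows "x \<in> K t"
proof -
  obtain m :: int where m: "m \<noteq> 0" "h * t = 2 * pi * m" using h by (auto simp: H_def)
  have h0: "h > 0" using h by (simp add: H_def lambdas_def)
  have "Phi t x = (sin (h * t) / h) *\<^sub>R x + ((1 - cos (h * t)) / h\<^sup>2) *\<^sub>R J x"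
  proof (rule PhiI)
    fix s
    show "((\<lambda>s. (sin (h * s) / h) *\<^sub>R x + ((1 - cos (h * s)) / h\<^sup>2) *\<^sub>R J x) has_vector_derivative E s x) (at s)"
      unfolding expT_rotation[OF linear_J _ x(2), of s, simplified h0]
      using h0 by (auto intro!: derivative_eq_intros simp: expT_rotation[OF linear_J _ x(2)] field_simps power2_eq_square)
  qed simp
  moreover have "sin (h * t) = 0" "cos (h * t) = 1"
    unfolding m(2) by (simp_all add: sin_zero_iff_int2 cos_one_2pi_int)
  ultimately show ?thesis using x by (simp add: K_def)
qed

text \<open>On the kernel the flow has period \<open>t\<close> by \<open>Phi_J\<close>, and
  \<open>J\<close> is injective because \<open>J x = 0\<close> gives \<open>Phi t x = t x\<close>;
  so the averaging argument applies.\<close>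

lemma K_eq_span:
  assumes t: "t \<noteq> 0"
  shows "K t = span (\<Union>h\<in>H t. {x \<in> V. J (J x) = - (h\<^sup>2) *\<^sub>R x})"
proof
  have inj: "x = 0" if "x \<in> K t" "J x = 0" for x
  proof -
    have "Phi t x = t *\<^sub>R x"
    proof (rule PhiI)
      fix s
      have "E s x = x"
        by (rule expT_unique[OF linear_J, of "\<lambda>_. x", symmetric]) (simp add: that)
      then show "((\<lambda>s. s *\<^sub>R x) has_vector_derivative E s x) (at s)"
        by (auto intro!: derivative_eq_intros)
    qed simp
    then show ?thesis using that t by (simp add: K_def)
  qed
  have "K t \<subseteq> span (\<Union>h\<in>{h. h > 0 \<and> (\<exists>m::int. m \<noteq> 0 \<and> h * t = 2 * pi * m)}. {x \<in> K t. J (J x) = - (h\<^sup>2) *\<^sub>R x})"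
    by (rule periodic_spanned_by_eigenvectors[OF linear_J subspace_K K_J inj t K_periodic])
  also have "\<dots> \<subseteq> span (\<Union>h\<in>H t. {x \<in> V. J (J x) = - (h\<^sup>2) *\<^sub>R x})" (is "_ \<subseteq> span ?S")
  proof (rule span_minimal)
    show "(\<Union>h\<in>{h. h > 0 \<and> (\<exists>m::int. m \<noteq> 0 \<and> h * t = 2 * pi * m)}. {x \<in> K t. J (J x) = - (h\<^sup>2) *\<^sub>R x}) \<subseteq> span ?S"
    proof safe
      fix h x and m :: int
      assume *: "h > 0" "real_of_int m \<noteq> 0" "h * t = 2 * pi * m" "x \<in> K t" "J (J x) = - (h\<^sup>2) *\<^sub>R x"
      show "x \<in> span ?S"
      proof (cases "x = 0")
        case False
        then have "h \<in> H t" using * by (auto simp: H_def lambdas_def K_def)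
        then show ?thesis using * by (intro span_base UN_I[of h]) (auto simp: K_def)
      qed (simp add: span_0)
    qed
  qed simp
  finally show "K t \<subseteq> span ?S" .
  show "span ?S \<subseteq> K t"
    using eigenspace_subset_K[OF t] by (intro span_minimal subspace_K) auto
qed

lemma finite_lambdas: "finite \<Lambda>"
proof -
  have "(\<lambda>h. - (h\<^sup>2)) ` \<Lambda> \<subseteq> {c. \<exists>x\<in>V. x \<noteq> 0 \<and> J (J x) = c *\<^sub>R x}"
    by (auto simp: lambdas_def)
  then have "finite ((\<lambda>h. - (h\<^sup>2)) ` \<Lambda>)"
    using finite_eigenvalues[OF linear_JJ subspace_V] finite_subset by blast
  then show ?thesis by (rule finite_imageD) (auto simp: inj_on_def lambdas_def)
qed

lemma dim_K:
  assumes t: "t \<noteq> 0"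
  shows "dim (K t) = (\<Sum>h\<in>H t. kdim br B (a *\<^sub>R e) h)"
proof -
  have fin: "finite (H t)" using finite_lambdas by (simp add: H_def)
  have inj: "inj_on (\<lambda>h. - (h\<^sup>2)) (H t)" by (auto simp: inj_on_def H_def lambdas_def)
  have "K t = span (\<Union>c\<in>(\<lambda>h. - (h\<^sup>2)) ` H t. {x \<in> V. J (J x) = c *\<^sub>R x})"
    unfolding K_eq_span[OF t] by simp
  then have "dim (K t) = (\<Sum>c\<in>(\<lambda>h. - (h\<^sup>2)) ` H t. dim {x \<in> V. J (J x) = c *\<^sub>R x})"
    by (simp only: dim_span_eigenspaces[OF linear_JJ subspace_V finite_imageI[OF fin]])
  also have "\<dots> = (\<Sum>h\<in>H t. dim {x \<in> V. J (J x) = - (h\<^sup>2) *\<^sub>R x})"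
    by (simp add: sum.reindex[OF inj])
  also have "\<dots> = (\<Sum>h\<in>H t. kdim br B (a *\<^sub>R e) h)"
    unfolding kdim_def scaleR_minus_left eq_neg_iff_add_eq_0 ..
  finally show ?thesis .
qed

lemma conj_times_iff: "t \<in> conj_times br B (a *\<^sub>R e) \<longleftrightarrow> t \<noteq> 0 \<and> H t \<noteq> {}"
proof
  assume "t \<in> conj_times br B (a *\<^sub>R e)"
  then obtain l and n :: int where "l \<in> \<Lambda>" "n \<noteq> 0" "t = 2 * pi / l * n" by (auto simp: conj_times_def)
  then show "t \<noteq> 0 \<and> H t \<noteq> {}" by (auto simp: H_def lambdas_def)
next
  assume "t \<noteq> 0 \<and> H t \<noteq> {}"
  then obtain l and n :: int where "l \<in> \<Lambda>" "n \<noteq> 0" "l * t = 2 * pi * n" by (auto simp: H_def)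
  then have "t = 2 * pi / l * n" by (auto simp: lambdas_def field_simps)
  then show "t \<in> conj_times br B (a *\<^sub>R e)" unfolding conj_times_def using \<open>l \<in> \<Lambda>\<close> \<open>n \<noteq> 0\<close> by blast
qed

text \<open>For \<open>t = 2 pi n / l\<close> the equations \<open>h = m l / n\<close> and
  \<open>h t = 2 pi m\<close> agree, with the same nonzero integer \<open>m\<close>.\<close>

lemma Ssum_eq:
  assumes l: "l \<in> \<Lambda>" and n: "n \<noteq> 0"
  shows "Ssum br B (a *\<^sub>R e) l n = dim (K (2 * pi / l * of_int n))"
proof -
  have l0: "l > 0" using l by (simp add: lambdas_def)
  have "rdvd (l / of_int n) h \<longleftrightarrow> (\<exists>m::int. m \<noteq> 0 \<and> h * (2 * pi / l * of_int n) = 2 * pi * m)" for h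
    unfolding rdvd_def using l0 n by (intro ex_cong1 conj_cong refl) (auto simp: field_simps)
  then have "{h \<in> \<Lambda>. rdvd (l / of_int n) h} = H (2 * pi / l * of_int n)" by (simp add: H_def)
  then show ?thesis using l0 n by (simp add: Ssum_def dim_K)
qed

lemma conj_times_iff_K: "t \<in> conj_times br B (a *\<^sub>R e) \<longleftrightarrow> t \<noteq> 0 \<and> dim (K t) \<noteq> 0"
proof (cases "t = 0")
  case False
  have "dim (K t) = 0" if "H t = {}" using that False by (simp add: dim_K)
  moreover have "dim (K t) \<noteq> 0" if h: "h \<in> H t" for h
  proof -
    obtain x where "x \<in> V" "x \<noteq> 0" "J (J x) = - (h\<^sup>2) *\<^sub>R x" using h by (auto simp: H_def lambdas_def)
    then have "x \<in> K t" "x \<noteq> 0" using eigenspace_subset_K[OF False h] by auto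
    then show ?thesis by (auto simp: subset_iff)
  qed
  ultimately show ?thesis using False by (auto simp: conj_times_iff)
qed (simp add: conj_times_iff)

lemma dim_K_le: "dim (K t) \<le> dim V"
  by (rule dim_subset) (auto simp: K_def)

end

lemma expJ_eq: "expJ br B z t x = expT (Jop br B z) t x"
  by (simp add: expJ_def expT_def)

context metric_two_step_geodesic
begin

section \<open>Initial velocities of fields vanishing at \<open>t\<close>\<close>

lemma zcoord_decomp: "u \<in> V \<Longrightarrow> zcoord (c *\<^sub>R e + u) = c"
  by (simp add: zcoord_add zcoord_scale zcoord_V_zero)

lemma solvI:
  "(\<And>s. (g has_vector_derivative E s (p - zcoord p *\<^sub>R e) + (zcoord p * s) *\<^sub>R L (E s x0)) (at s)) \<Longrightarrow> g 0 = 0 \<Longrightarrow> solv p s = g s"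
  unfolding solv_def by (rule fun_cong[OF prim_unique[OF continuous_solv_integrand]])

lemma solzI:
  "(\<And>s. (g has_vector_derivative zcoord p - B (L (E s x0)) (solv p s) / B e e) (at s)) \<Longrightarrow> g 0 = 0 \<Longrightarrow> solz p s = g s"
  by (rule has_vector_derivative_unique_at_0[OF solz_deriv, of g]) auto

text \<open>With \<open>x0 = 0\<close> the central coefficient is \<open>zcoord p * t\<close>, so
  \<open>p\<close> must lie in \<open>V\<close>, where the field at time \<open>t\<close> is
  \<open>Phi t p\<close>.\<close>

lemma zero_set_central:
  assumes x0_eq: "x0 = 0" and t: "t \<noteq> 0"
  shows "{p. sol p t = 0} = K t"
proof -
  have z: "solz p t = zcoord p * t" for p
    by (rule solzI) (auto intro!: derivative_eq_intros simp: x0_eq E_simps L_simps B_simps)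
  have v: "solv p t = Phi t (p - zcoord p *\<^sub>R e)" for p
    by (rule solvI) (simp_all add: Phi_deriv x0_eq L_simps linear_0[OF linear_expT[OF linear_J]])
  have "sol p t = 0 \<longleftrightarrow> p \<in> K t" for p
  proof (cases "zcoord p = 0")
    case True
    then have "p \<in> V" using Bee by (simp add: zcoord_def V_iff)
    then show ?thesis using True by (simp add: sol_zero_iff z v K_def)
  next
    case False
    then have "p \<notin> V" using zcoord_V_zero by blast
    then show ?thesis using False t by (simp add: sol_zero_iff z K_def)
  qed
  then show ?thesis by blast
qed

text \<open>With \<open>a = 0\<close> the flow is trivial and the fields are polynomial in time. The
  \<open>V\<close> equation fixes \<open>p\<close> up to its central coordinate \<open>c\<close>,
  and the central equation then says that \<open>c\<close> times a scalar is 0.\<close>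

lemma zero_set_horizontal:
  assumes a: "a = 0" and t: "t \<noteq> 0"
  shows "{p. sol p t = 0} = (if B e e + t\<^sup>2 / 12 * B (L x0) (L x0) = 0 then span {e - (t / 2) *\<^sub>R L x0} else {0})"
proof -
  let ?Q = "B (L x0) (L x0)"
  let ?w = "e - (t / 2) *\<^sub>R L x0"
  have J0: "J x = 0" for x by (subst J_eq) (simp add: a)
  have E: "E s x = x" for s x
    by (rule expT_unique[OF linear_J, of "\<lambda>_. x", symmetric]) (simp add: J0)
  have v: "solv p s = s *\<^sub>R (p - zcoord p *\<^sub>R e) + (zcoord p * s\<^sup>2 / 2) *\<^sub>R L x0" for p s
    by (rule solvI) (auto intro!: derivative_eq_intros simp: E power2_eq_square)
  have z: "solz p s = zcoord p * s - (s\<^sup>2 / 2 * B (L x0) (p - zcoord p *\<^sub>R e) + zcoord p * s^3 / 6 * ?Q) / B e e" for p s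
  proof (rule solzI)
    fix s
    show "((\<lambda>s. zcoord p * s - (s\<^sup>2 / 2 * B (L x0) (p - zcoord p *\<^sub>R e) + zcoord p * s^3 / 6 * ?Q) / B e e)
        has_vector_derivative zcoord p - B (L (E s x0)) (solv p s) / B e e) (at s)"
    proof -
      have "((\<lambda>s. c * s - (s\<^sup>2 / 2 * b + c * s ^ 3 / 6 * q) / k) has_real_derivative
        c - (s * b + c * s\<^sup>2 / 2 * q) / k) (at s)" for c b q k :: real
        by (cases "k = 0") (auto intro!: derivative_eq_intros simp: field_simps power2_eq_square)
      then show ?thesis
        unfolding has_real_derivative_iff_has_vector_derivative by (simp add: E v B_simps)
    qed
  qed simp
  have iff: "sol p t = 0 \<longleftrightarrow> p = zcoord p *\<^sub>R ?w \<and> zcoord p * (B e e + t\<^sup>2 / 12 * ?Q) = 0" for p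
  proof -
    have "solv p t = t *\<^sub>R (p - zcoord p *\<^sub>R ?w)"
      by (simp add: v algebra_simps power2_eq_square)
    then have v0: "solv p t = 0 \<longleftrightarrow> p = zcoord p *\<^sub>R ?w" using t by simp
    have "solz p t = 0 \<longleftrightarrow> zcoord p * (B e e + t\<^sup>2 / 12 * ?Q) = 0" if "p = zcoord p *\<^sub>R ?w"
    proof -
      have "p - zcoord p *\<^sub>R e = - (zcoord p * t / 2) *\<^sub>R L x0" by (subst (1) that) (simp add: algebra_simps)
      then have bq: "B (L x0) (p - zcoord p *\<^sub>R e) = - (zcoord p * t / 2) * ?Q" by (simp only: B_simps real_scaleR_def)
      \<comment> \<open>The coefficient 1/12 is 1/4 - 1/6: the first comes from the \<open>V\<close>
        part of \<open>p\<close>, the second from the forced cubic term.\<close>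
      have "solz p t = t / B e e * (zcoord p * (B e e + t\<^sup>2 / 12 * ?Q))"
        unfolding z bq using Bee by (simp add: field_simps power2_eq_square power3_eq_cube)
      then show ?thesis using t Bee by simp
    qed
    then show ?thesis using v0 by (auto simp: sol_zero_iff)
  qed
  have cw: "zcoord (c *\<^sub>R ?w) = c" for c
    using Bee by (simp add: zcoord_def B_simps)
  have sp: "p = zcoord p *\<^sub>R ?w \<longleftrightarrow> p \<in> span {?w}" for p
  proof
    assume "p = zcoord p *\<^sub>R ?w"
    then show "p \<in> span {?w}" unfolding span_singleton by (rule range_eqI)
  next
    assume "p \<in> span {?w}"
    then obtain k where k: "p = k *\<^sub>R ?w" unfolding span_singleton by blast
    have "zcoord p = k" unfolding k by (rule cw)
    show "p = zcoord p *\<^sub>R ?w" unfolding \<open>zcoord p = k\<close> by (rule k)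
  qed
  show ?thesis
  proof (cases "B e e + t\<^sup>2 / 12 * ?Q = 0")
    case True
    have "sol p t = 0 \<longleftrightarrow> p \<in> span {?w}" for p unfolding iff sp[symmetric] True by simp
    then show ?thesis unfolding if_P[OF True] by blast
  next
    case False
    have "sol p t = 0 \<longleftrightarrow> p = 0" for p
    proof -
      have "p = 0" if "p = zcoord p *\<^sub>R ?w" "zcoord p = 0" using that(1) unfolding that(2) by simp
      moreover have "zcoord 0 = 0" using zcoord_scale[of 0 0] by simp
      ultimately show ?thesis unfolding iff using False by auto
    qed
    then show ?thesis unfolding if_not_P[OF False] by blast
  qed
qed

text \<open>In this parametrisation the integrand of \<open>solv\<close> is a total derivative:
  \<open>c (E s x0 + s L (E s x0))\<close> is that of \<open>c s E s x0\<close>, and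
  \<open>E s (L y)\<close> is that of \<open>E s y\<close>.\<close>

lemma sol_zero_iff_generic:
  assumes a: "a = 1" and t: "t \<noteq> 0" and y: "y \<in> V"
  shows "sol (c *\<^sub>R (e + x0) + L y) t = 0 \<longleftrightarrow>
     E (- t) y - y = (c * t) *\<^sub>R x0 \<and> c * (B e e + B x0 x0) = B (L x0) y"
proof -
  define p where "p = c *\<^sub>R (e + x0) + L y"
  have p: "p = c *\<^sub>R e + (c *\<^sub>R x0 + L y)" by (simp add: p_def algebra_simps)
  have cfp: "zcoord p = c"
    unfolding p by (rule zcoord_decomp) (simp add: subspace_add[OF subspace_V] subspace_scale[OF subspace_V] x0)
  have pe: "p - zcoord p *\<^sub>R e = c *\<^sub>R x0 + L y" unfolding cfp by (simp add: p)
  have J: "J x = L x" for x by (simp add: J_eq a)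
  have dE: "((\<lambda>s. E s x) has_vector_derivative L (E s x)) (at s)" for s x using E_deriv[of x s] by (simp add: a)
  have v: "solv p s = Phi s (L y) + (c * s) *\<^sub>R E s x0" for s
    by (rule solvI, unfold pe, unfold cfp) (auto intro!: derivative_eq_intros Phi_deriv dE simp: E_simps algebra_simps)
  have dB: "((\<lambda>s. B (E s x0) (Phi s (L y))) has_vector_derivative
       B (E s x0) (E s (L y)) + B (L (E s x0)) (Phi s (L y))) (at s)" for s
    by (rule bounded_bilinear.has_vector_derivative[OF bounded_bilinear_B dE Phi_deriv])
  \<comment> \<open>Integration by parts. The boundary term has the extra derivative
    \<open>B x0 (L y)\<close>, as the flow is isometric, and \<open>c s E s x0\<close> contributes
    nothing because \<open>B (L u) u = 0\<close>.\<close>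
  have z: "solz p s = c * s + (s * B x0 (L y) - B (E s x0) (Phi s (L y))) / B e e" for s
  proof (rule solzI)
    fix s
    have "B (L (E s x0)) (E s x0) = 0" using L_skew[of "E s x0" "E s x0"] by (simp add: B_sym)
    then have "zcoord p - B (L (E s x0)) (solv p s) / B e e = c + (B x0 (L y) - (B (E s x0) (E s (L y)) + B (L (E s x0)) (Phi s (L y)))) / B e e"
      by (simp add: cfp v B_simps B_E)
    with Bee show "((\<lambda>s. c * s + (s * B x0 (L y) - B (E s x0) (Phi s (L y))) / B e e)
        has_vector_derivative zcoord p - B (L (E s x0)) (solv p s) / B e e) (at s)"
      by (auto intro!: derivative_eq_intros dB[unfolded has_real_derivative_iff_has_vector_derivative[symmetric]]
         simp: has_real_derivative_iff_has_vector_derivative[symmetric])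
  qed (simp add: B_simps)
  have PL: "Phi t (L y) = E t y - y" using Phi_J[of t y] by (simp add: J)
  \<comment> \<open>Transport by the invertible \<open>E (- t)\<close> brings the equation into the
    form with \<open>E (- t) - I\<close>.\<close>
  have "solv p t = 0 \<longleftrightarrow> E (- t) (solv p t) = 0"
    using expT_minus(2)[OF linear_J] by (metis linear_0[OF linear_expT[OF linear_J]])
  also have "E (- t) (solv p t) = (c * t) *\<^sub>R x0 - (E (- t) y - y)"
    by (simp add: v PL E_simps linear_J)
  finally have v0: "solv p t = 0 \<longleftrightarrow> E (- t) y - y = (c * t) *\<^sub>R x0" by auto
  \<comment> \<open>The \<open>V\<close> equation replaces \<open>Phi t (L y)\<close> by
    \<open>- c t E t x0\<close>, which yields the summand \<open>B x0 x0\<close> of the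
    energy.\<close>
  have "solz p t = t / B e e * (c * (B e e + B x0 x0) - B (L x0) y)" if "solv p t = 0"
  proof -
    have "Phi t (L y) = - ((c * t) *\<^sub>R E t x0)" using that by (simp add: v add_eq_0_iff2)
    then have "B (E t x0) (Phi t (L y)) = - (c * t * B x0 x0)" by (simp add: B_simps B_E)
    then show ?thesis unfolding z using Bee by (simp add: L_skew field_simps)
  qed
  then have "sol p t = 0 \<longleftrightarrow> solv p t = 0 \<and> c * (B e e + B x0 x0) - B (L x0) y = 0"
    using t Bee by (auto simp: sol_zero_iff)
  then show ?thesis unfolding v0 unfolding p_def by simp
qed

end

section \<open>The case of invertible \<open>J\<close>\<close>

locale metric_two_step_invertible = metric_two_step_geodesic +
  assumes a: "a = 1" and inj: "\<And>x. x \<in> V \<Longrightarrow> L x = 0 \<Longrightarrow> x = 0"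
begin

text \<open>The constant value of the metric on the velocity, since here
  \<open>z0 = e\<close>.\<close>

definition energy :: real where "energy = B e e + B x0 x0"

lemma J_L: "J x = L x"
  by (simp add: J_eq a)

lemma L_onto_V:
  assumes "y \<in> V" obtains x where "x \<in> V" "L x = y"
  using linear_injective_on_imp_surjective_on[OF linear_L subspace_V L_V inj assms] .

text \<open>\<open>J\<close> composed with \<open>Phi t\<close> is \<open>E t - I\<close>, and
  \<open>J\<close> is injective on \<open>V\<close>.\<close>

lemma K_iff:
  assumes y: "y \<in> V"
  shows "E (- t) y - y = 0 \<longleftrightarrow> y \<in> K t"
proof
  assume "E (- t) y - y = 0"
  then have "E t y = y" using expT_minus(2)[OF linear_J, of t y] by simp
  then have "L (Phi t y) = 0" using J_Phi[of t y] Phi_J[of t y] by (simp add: J_L)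
  then show "y \<in> K t" using inj Phi_V y by (simp add: K_def)
next
  assume "y \<in> K t"
  then have "E t y = y" by (rule K_periodic)
  then show "E (- t) y - y = 0" using expT_minus(1)[OF linear_J, of t y] by simp
qed

lemma K_sub_V: "y \<in> K t \<Longrightarrow> y \<in> V"
  by (simp add: K_def)

lemma K_L: "y \<in> K t \<Longrightarrow> L y \<in> K t"
  using K_J[of y t] by (simp add: J_L)

lemma L_onto_K:
  assumes "y \<in> K t" obtains x where "x \<in> K t" "L x = y"
  using linear_injective_on_imp_surjective_on[OF linear_L subspace_K K_L inj[OF K_sub_V] assms] .

lemma B_range_K:
  assumes k: "k \<in> K t"
  shows "B (E (- t) v - v) k = 0"
  using B_E[of t "E (- t) v" k] K_periodic[OF k] expT_minus(2)[OF linear_J, of t v] by (simp add: B_simps)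

lemma zero_set_iff:
  assumes t: "t \<noteq> 0"
  shows "sol p t = 0 \<longleftrightarrow> (\<exists>c y. y \<in> V \<and> p = c *\<^sub>R (e + x0) + L y \<and>
    E (- t) y - y = (c * t) *\<^sub>R x0 \<and> c * energy = B (L x0) y)"
proof
  assume *: "sol p t = 0"
  have "p - zcoord p *\<^sub>R e - zcoord p *\<^sub>R x0 \<in> V"
    by (intro subspace_diff[OF subspace_V zcoord_V] subspace_scale[OF subspace_V] x0)
  then obtain y where y: "y \<in> V" "L y = p - zcoord p *\<^sub>R e - zcoord p *\<^sub>R x0" by (rule L_onto_V)
  have p: "p = zcoord p *\<^sub>R (e + x0) + L y" by (simp add: y algebra_simps)
  have "sol (zcoord p *\<^sub>R (e + x0) + L y) t = 0" using * p by simp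
  then have "E (- t) y - y = (zcoord p * t) *\<^sub>R x0 \<and> zcoord p * energy = B (L x0) y"
    unfolding sol_zero_iff_generic[OF a t y(1)] energy_def .
  with p y(1) show "\<exists>c y. y \<in> V \<and> p = c *\<^sub>R (e + x0) + L y \<and>
    E (- t) y - y = (c * t) *\<^sub>R x0 \<and> c * energy = B (L x0) y" by blast
next
  assume "\<exists>c y. y \<in> V \<and> p = c *\<^sub>R (e + x0) + L y \<and>
    E (- t) y - y = (c * t) *\<^sub>R x0 \<and> c * energy = B (L x0) y"
  then show "sol p t = 0" using sol_zero_iff_generic[OF a t] unfolding energy_def by blast
qed

text \<open>The solutions of \<open>E (- t) y - y = c t x0\<close> are \<open>y = k + c v\<close>
  with \<open>k\<close> in the kernel. The second equation reduces to
  \<open>c (energy - B (L x0) v) = 0\<close>, so \<open>c\<close> is free exactly in the case of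
  equality.\<close>

lemma dim_zero_set_range:
  assumes t: "t \<noteq> 0" and v: "v \<in> V" "E (- t) v - v = t *\<^sub>R x0"
  shows "dim {p. sol p t = 0} = (if B (L x0) v = energy then dim (K t) + 1 else dim (K t))"
proof -
  have lin: "E (- t) (y + c *\<^sub>R v) - (y + c *\<^sub>R v) = (E (- t) y - y) + (c * t) *\<^sub>R x0" for y c
  proof -
    have "E (- t) (y + c *\<^sub>R v) - (y + c *\<^sub>R v) = (E (- t) y - y) + c *\<^sub>R (E (- t) v - v)"
      by (simp add: E_simps algebra_simps)
    then show ?thesis unfolding v(2) by simp
  qed
  \<comment> \<open>\<open>t x0\<close> is in the range, hence orthogonal to the kernel, which
    \<open>L\<close> preserves. This is also why \<open>B (L x0) v\<close> does not depend on the
    choice of \<open>v\<close>.\<close>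
  have orth: "B (L x0) k = 0" if k: "k \<in> K t" for k
  proof -
    have "t * B x0 (L k) = 0"
      using B_range_K[OF K_L[OF k], of v] unfolding v(2) by (simp add: B_simps)
    then show ?thesis using t by (simp add: L_skew)
  qed
  define g where "g = e + x0 + L v"
  have iff: "sol p t = 0 \<longleftrightarrow> (\<exists>c. \<exists>k\<in>K t. p = c *\<^sub>R g + k \<and> c * (energy - B (L x0) v) = 0)" for p
  proof
    assume "sol p t = 0"
    then obtain c y where y: "y \<in> V" "p = c *\<^sub>R (e + x0) + L y"
      "E (- t) y - y = (c * t) *\<^sub>R x0" "c * energy = B (L x0) y"
      unfolding zero_set_iff[OF t] by blast
    define k where "k = y - c *\<^sub>R v"
    have kV: "k \<in> V" unfolding k_def using y(1) v(1) subspace_V by (intro subspace_diff subspace_scale)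
    have yk: "y = k + c *\<^sub>R v" by (simp add: k_def)
    have "E (- t) k - k = 0" using y(3) lin[of k c] unfolding yk by simp
    then have k: "k \<in> K t" using K_iff[OF kV] by simp
    have "c * (energy - B (L x0) v) = 0"
      using y(4) orth[OF k] unfolding yk by (simp add: B_simps algebra_simps)
    moreover have "p = c *\<^sub>R g + L k" unfolding y(2) yk by (simp add: g_def L_simps algebra_simps)
    ultimately show "\<exists>c. \<exists>k\<in>K t. p = c *\<^sub>R g + k \<and> c * (energy - B (L x0) v) = 0"
      using K_L[OF k] by blast
  next
    assume "\<exists>c. \<exists>k\<in>K t. p = c *\<^sub>R g + k \<and> c * (energy - B (L x0) v) = 0"
    then obtain c k' where k': "k' \<in> K t" "p = c *\<^sub>R g + k'" "c * (energy - B (L x0) v) = 0" by blast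
    \<comment> \<open>\<open>L\<close> maps the kernel onto itself, so the summand
      \<open>L k\<close> runs through all of it.\<close>
    obtain k where k: "k \<in> K t" "L k = k'" using k'(1) by (rule L_onto_K)
    have "k + c *\<^sub>R v \<in> V" using K_sub_V[OF k(1)] v(1) subspace_V by (intro subspace_add subspace_scale)
    moreover have "p = c *\<^sub>R (e + x0) + L (k + c *\<^sub>R v)"
      unfolding k'(2) k(2)[symmetric] by (simp add: g_def L_simps algebra_simps)
    moreover have "E (- t) (k + c *\<^sub>R v) - (k + c *\<^sub>R v) = (c * t) *\<^sub>R x0"
      using K_iff[OF K_sub_V[OF k(1)]] k(1) unfolding lin by simp
    moreover have "c * energy = B (L x0) (k + c *\<^sub>R v)"
      using k'(3) orth[OF k(1)] by (simp add: B_simps algebra_simps)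
    ultimately show "sol p t = 0" unfolding zero_set_iff[OF t] by blast
  qed
  show ?thesis
  proof (cases "B (L x0) v = energy")
    case True
    have sp: "span (K t) = K t" using subspace_K by (simp only: span_eq_iff)
    have "sol p t = 0 \<longleftrightarrow> p \<in> span (insert g (K t))" for p
    proof -
      have "p \<in> span (insert g (K t)) \<longleftrightarrow> (\<exists>c. p - c *\<^sub>R g \<in> K t)"
        unfolding span_insert sp by simp
      also have "\<dots> \<longleftrightarrow> (\<exists>c. \<exists>k\<in>K t. p = c *\<^sub>R g + k)"
        by (metis add_diff_cancel_left' diff_add_cancel add.commute)
      finally show ?thesis unfolding iff True by simp
    qed
    then have "{p. sol p t = 0} = span (insert g (K t))" by blast
    \<comment> \<open>The central coordinate of \<open>g\<close> is 1, whereas the kernel lies in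
      \<open>V\<close>.\<close>
    moreover have "g \<notin> span (K t)"
    proof
      assume "g \<in> span (K t)"
      then have "B e g = 0" unfolding sp using K_sub_V V_iff by blast
      then show False using Bee by (simp add: g_def B_simps)
    qed
    ultimately show ?thesis unfolding if_P[OF True] by (simp only: dim_span dim_insert if_False)
  next
    case False
    have "sol p t = 0 \<longleftrightarrow> p \<in> K t" for p
      unfolding iff using False by auto
    then have "{p. sol p t = 0} = K t" by blast
    then show ?thesis unfolding if_not_P[OF False] by (rule arg_cong)
  qed
qed

text \<open>The range of \<open>E (- t) - I\<close> is the orthogonal complement of \<open>K t\<close> in \<open>V\<close>; hence \<open>x0\<close> outside the range
  forces the central coordinate to vanish and pairs nontrivially with \<open>K t\<close>.\<close>

lemma dim_zero_set_not_range:
  assumes t: "t \<noteq> 0" and nr: "\<And>v. v \<in> V \<Longrightarrow> E (- t) v - v \<noteq> x0"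
  shows "dim (K t) = dim {p. sol p t = 0} + 1"
proof -
  have iff: "sol p t = 0 \<longleftrightarrow> p \<in> K t \<and> B x0 p = 0" for p
  proof
    assume "sol p t = 0"
    then obtain c y where y: "y \<in> V" "p = c *\<^sub>R (e + x0) + L y"
      "E (- t) y - y = (c * t) *\<^sub>R x0" "c * energy = B (L x0) y"
      unfolding zero_set_iff[OF t] by blast
    \<comment> \<open>Otherwise \<open>y / (c t)\<close> would be a preimage of
      \<open>x0\<close>.\<close>
    have "c = 0"
    proof (rule ccontr)
      assume "c \<noteq> 0"
      then have "E (- t) ((1 / (c * t)) *\<^sub>R y) - (1 / (c * t)) *\<^sub>R y = x0"
        using y(3) t by (simp add: E_simps scaleR_diff_right[symmetric])
      then show False using nr y(1) subspace_scale[OF subspace_V] by blast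
    qed
    then have "y \<in> K t" "p = L y" "B x0 (L y) = 0"
      using y K_iff[OF y(1), of t] by (simp_all add: L_skew)
    then show "p \<in> K t \<and> B x0 p = 0" using K_L by blast
  next
    assume p: "p \<in> K t \<and> B x0 p = 0"
    then obtain y where y: "y \<in> K t" "L y = p" using L_onto_K by blast
    have "p = 0 *\<^sub>R (e + x0) + L y" "E (- t) y - y = (0 * t) *\<^sub>R x0" "0 * energy = B (L x0) y"
      using K_iff[OF K_sub_V[OF y(1)], of t] y p by (simp_all add: L_skew)
    then show "sol p t = 0" unfolding zero_set_iff[OF t] using K_sub_V[OF y(1)] by blast
  qed
  have linM: "linear (\<lambda>v. E (- t) v - v)"
    by (rule linearI) (simp_all add: E_simps algebra_simps)
  define S where "S = (\<lambda>v. E (- t) v - v) ` V"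
  have S: "subspace S" unfolding S_def by (rule linear_subspace_image[OF linM subspace_V])
  \<comment> \<open>The Euclidean normal component \<open>z\<close> of \<open>x0\<close> relative to
    the range is nonzero. Its functional vanishes on the range but not at \<open>x0\<close>;
    represented by \<open>B\<close>, it will give the required kernel vector.\<close>
  obtain y z where yz: "y \<in> span S" "\<And>w. w \<in> span S \<Longrightarrow> orthogonal z w" "x0 = y + z"
    using orthogonal_subspace_decomp_exists[of S x0] by blast
  have "span S = S" using S by (simp only: span_eq_iff)
  moreover have "x0 \<notin> S" unfolding S_def using nr by blast
  ultimately have "x0 \<notin> span S" by blast
  then have "z \<noteq> 0" using yz by auto
  then have zx: "z \<bullet> x0 \<noteq> 0" using yz by (simp add: inner_add_right orthogonal_def)
  have "linear (\<lambda>w. z \<bullet> w)" by (simp add: linear_conv_bounded_linear bounded_linear_inner_right)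
  then obtain k0 where k0: "\<And>w. B k0 w = z \<bullet> w" using B_representation by blast
  define k where "k = k0 - (B e k0 / B e e) *\<^sub>R e"
  have kV: "k \<in> V" unfolding k_def by (rule V_part)
  have Bk: "B k w = z \<bullet> w" if "w \<in> V" for w
    using that k0 by (simp add: k_def B_simps V_iff)
  \<comment> \<open>The \<open>B\<close>-adjoint of \<open>E (- t)\<close> is \<open>E t\<close>, so
    a vector of \<open>V\<close> orthogonal to the range is fixed by the flow.\<close>
  have "E t k - k = 0"
  proof (rule V_nondegenerate)
    show "E t k - k \<in> V" using kV by (intro subspace_diff[OF subspace_V]) auto
    fix w assume w: "w \<in> V"
    have MV: "E (- t) w - w \<in> V" using w by (intro subspace_diff[OF subspace_V]) auto
    have "E (- t) w - w \<in> span S" using w by (intro span_base) (auto simp: S_def)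
    then have "B k (E (- t) w - w) = 0" using yz(2) Bk[OF MV] by (simp add: orthogonal_def)
    moreover have "B (E t k) w = B k (E (- t) w)"
      using B_E[of t k "E (- t) w"] expT_minus(2)[OF linear_J, of t w] by simp
    ultimately show "B (E t k - k) w = 0" by (simp add: B_simps)
  qed
  then have "E (- t) k - k = 0" using expT_minus(1)[OF linear_J, of t k] by simp
  then have kK: "k \<in> K t" using K_iff[OF kV] by blast
  have kx: "B x0 k \<noteq> 0" using zx Bk[OF x0] B_sym[of x0 k] by simp
  let ?P = "{p. sol p t = 0}"
  have P: "?P = {p \<in> K t. B x0 p = 0}" using iff by blast
  have subP: "subspace ?P"
    unfolding P using subspace_K[of t] by (auto simp: subspace_def B_simps)
  have spP: "span ?P = ?P" using subP by (simp only: span_eq_iff)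
  have "K t = span (insert k ?P)"
  proof
    show "span (insert k ?P) \<subseteq> K t" using kK by (intro span_minimal subspace_K) (auto simp: P)
    show "K t \<subseteq> span (insert k ?P)"
    proof
      fix y assume y: "y \<in> K t"
      have "y - (B x0 y / B x0 k) *\<^sub>R k \<in> ?P"
        unfolding P using y kK kx subspace_K[of t]
        by (simp add: subspace_diff subspace_scale B_simps)
      then show "y \<in> span (insert k ?P)" unfolding span_insert spP by blast
    qed
  qed
  moreover have "k \<notin> span ?P" unfolding spP unfolding P using kx by blast
  ultimately show ?thesis by (simp only: dim_span dim_insert if_False)
qed

text \<open>A one-dimensional kernel would be an \<open>L\<close>-invariant line, with a real
  \<open>c\<close> such that \<open>c^2 = -h^2\<close>. Hence a nonzero kernel keeps a positive
  dimension when one is lost.\<close>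

lemma dim_K_ne_1:
  assumes t: "t \<noteq> 0"
  shows "dim (K t) \<noteq> 1"
proof
  assume d: "dim (K t) = 1"
  have "H t \<noteq> {}"
  proof
    assume "H t = {}"
    then have "dim (K t) = 0" unfolding dim_K[OF t] by simp
    then show False unfolding d by simp
  qed
  then obtain h where h: "h \<in> H t" by blast
  then obtain k where k: "k \<in> V" "k \<noteq> 0" "J (J k) = - (h\<^sup>2) *\<^sub>R k" and h0: "h > 0"
    by (auto simp: H_def lambdas_def)
  have kK: "k \<in> K t" using eigenspace_subset_K[OF t h k(1,3)] .
  have "k \<notin> span {}" using k by (simp add: span_empty)
  then have "dim (span {k}) = 1" by (simp only: dim_span dim_insert if_False dim_empty)
  moreover have "span {k} \<subseteq> K t" using kK by (intro span_minimal subspace_K) simp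
  ultimately have "span {k} = K t"
    using d by (intro subspace_dim_equal subspace_span subspace_K) simp_all
  then have "L k \<in> span {k}" using K_L[OF kK] by simp
  then obtain c where c: "L k = c *\<^sub>R k" unfolding span_singleton by blast
  have "c\<^sup>2 *\<^sub>R k = - (h\<^sup>2) *\<^sub>R k"
    using k(3) by (simp add: J_L c L_simps power2_eq_square)
  then have "c\<^sup>2 = - (h\<^sup>2)" using k(2) unfolding scaleR_cancel_right by blast
  then show False using h0 zero_le_power2[of c] zero_less_power[of h 2] by linarith
qed

text \<open>If \<open>t x0\<close> is not in the range, the kernel is nonzero and loses one
  dimension, but it has at least two, so \<open>t\<close> is conjugate. Otherwise the dimension
  formula decides.\<close>

lemma conjugate_iff_range:
  assumes t: "t \<noteq> 0"
  shows "conjugate br B (a *\<^sub>R e) x0 t \<longleftrightarrow> dim (K t) \<noteq> 0 \<or>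
    (\<exists>v\<in>V. E (- t) v - v = t *\<^sub>R x0 \<and> B (L x0) v = energy)"
proof -
  let ?d = "dim {p. sol p t = 0}"
  have c: "conjugate br B (a *\<^sub>R e) x0 t \<longleftrightarrow> ?d \<noteq> 0" unfolding conjugate_iff_dim using t by blast
  show ?thesis
proof (cases "\<exists>v\<in>V. E (- t) v - v = t *\<^sub>R x0")
  case True
  then obtain v where v: "v \<in> V" "E (- t) v - v = t *\<^sub>R x0" by blast
  show ?thesis
    unfolding c
  proof
    assume "?d \<noteq> 0"
    then show "dim (K t) \<noteq> 0 \<or> (\<exists>v\<in>V. E (- t) v - v = t *\<^sub>R x0 \<and> B (L x0) v = energy)"
      using v unfolding dim_zero_set_range[OF t v] by (auto simp del: dim_eq_0 split: if_splits)
  next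
    assume "dim (K t) \<noteq> 0 \<or> (\<exists>v\<in>V. E (- t) v - v = t *\<^sub>R x0 \<and> B (L x0) v = energy)"
    then show "?d \<noteq> 0"
    proof
      assume "dim (K t) \<noteq> 0"
      then show ?thesis unfolding dim_zero_set_range[OF t v] by (simp del: dim_eq_0)
    next
      assume "\<exists>v\<in>V. E (- t) v - v = t *\<^sub>R x0 \<and> B (L x0) v = energy"
      then obtain w where w: "w \<in> V" "E (- t) w - w = t *\<^sub>R x0" and e: "B (L x0) w = energy" by blast
      \<comment> \<open>The dimension formula holds for any preimage of \<open>t x0\<close>, so it
        is applied to the one satisfying the energy equation.\<close>
      show ?thesis unfolding dim_zero_set_range[OF t w] if_P[OF e] by simp
    qed
  qed
next
  case False
  have "E (- t) v - v \<noteq> x0" if "v \<in> V" for v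
  proof
    assume "E (- t) v - v = x0"
    then have "E (- t) (t *\<^sub>R v) - t *\<^sub>R v = t *\<^sub>R x0" by (simp add: E_simps scaleR_diff_right[symmetric])
    then show False using False subspace_scale[OF subspace_V that] by blast
  qed
  then have "dim (K t) = ?d + 1" by (rule dim_zero_set_not_range[OF t])
  then have "?d \<noteq> 0" "dim (K t) \<noteq> 0" using dim_K_ne_1[OF t] by linarith+
  then show ?thesis unfolding c by blast
qed
qed

text \<open>A trivial kernel makes \<open>E (- t) - I\<close> bijective on \<open>V\<close>; this
  gives meaning to the \<open>THE\<close> in the theorem.\<close>

lemma ex1_preimage:
  assumes t: "dim (K t) = 0" and y: "y \<in> V"
  shows "\<exists>!w. w \<in> V \<and> E (- t) w - w = y"
proof -
  have linM: "linear (\<lambda>v. E (- t) v - v)"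
    by (rule linearI) (simp_all add: E_simps algebra_simps)
  have K0: "w = 0" if "w \<in> V" "E (- t) w - w = 0" for w
    using that K_iff t by (metis dim_eq_0 singletonD subsetD)
  have MV: "E (- t) w - w \<in> V" if "w \<in> V" for w
    using that by (intro subspace_diff[OF subspace_V]) auto
  obtain w where w: "w \<in> V" "E (- t) w - w = y"
    using linear_injective_on_imp_surjective_on[OF linM subspace_V MV K0 y] .
  have "w' = w" if "w' \<in> V" "E (- t) w' - w' = y" for w'
  proof -
    have "E (- t) (w' - w) - (w' - w) = 0" using that(2) w(2) by (simp add: E_simps algebra_simps)
    then show ?thesis using K0[OF subspace_diff[OF subspace_V that(1) w(1)]] by simp
  qed
  then show ?thesis using w by blast
qed

end

section \<open>Assembly of the three cases\<close>

theorem mainTheorem5: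
  fixes br :: "'n::euclidean_space \<Rightarrow> 'n \<Rightarrow> 'n" and B :: "'n \<Rightarrow> 'n \<Rightarrow> real"
    and z0 x0 :: 'n
  assumes nil: "two_step_nilpotent br"
    and ip: "inner_product B"
    and znd: "\<forall>x\<in>center br. (\<forall>y\<in>center br. B x y = 0) \<longrightarrow> x = 0"
    and dimz: "dim (center br) = 1"
    and z0: "z0 \<in> center br" and x0: "x0 \<in> vpart br B"
  shows
   "(z0 \<noteq> 0 \<and> x0 = 0 \<longrightarrow>
       (\<forall>t. conjugate br B z0 x0 t \<longleftrightarrow> t \<in> conj_times br B z0) \<and>
       (\<forall>l\<in>lambdas br B z0. \<forall>n::int. n \<noteq> 0 \<longrightarrow>
          mult_cp br B z0 x0 (2 * pi / l * of_int n) = Ssum br B z0 l n \<and>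
          Ssum br B z0 l n \<le> dim (vpart br B)))
  \<and> (z0 = 0 \<and> x0 \<noteq> 0 \<longrightarrow>
       (\<forall>z\<in>center br. B z z \<in> {1, -1} \<longrightarrow>
         (\<forall>t. t \<noteq> 0 \<longrightarrow>
           (conjugate br B z0 x0 t \<longleftrightarrow>
              - 12 / t^2 = B z z * B (Jop br B z x0) (Jop br B z x0)) \<and>
           (conjugate br B z0 x0 t \<longrightarrow> mult_cp br B z0 x0 t = 1))))
  \<and> (z0 \<noteq> 0 \<and> x0 \<noteq> 0 \<and> (\<forall>x\<in>vpart br B. Jop br B z0 x = 0 \<longrightarrow> x = 0) \<longrightarrow>
       (\<forall>t. t \<noteq> 0 \<longrightarrow>
          (conjugate br B z0 x0 t \<longleftrightarrow>
             t \<in> conj_times br B z0 \<or>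
             (t \<notin> conj_times br B z0 \<and>
              t * B (Jop br B z0 x0)
                    (THE w. w \<in> vpart br B \<and> expJ br B z0 (- t) w - w = x0)
                = B z0 z0 + B x0 x0))) \<and>
       (\<forall>t. t \<noteq> 0 \<longrightarrow> t \<notin> conj_times br B z0 \<longrightarrow>
          (\<forall>y\<in>vpart br B. \<exists>!w. w \<in> vpart br B \<and> expJ br B z0 (- t) w - w = y)) \<and>
       (\<forall>t. t \<noteq> 0 \<longrightarrow> t \<notin> conj_times br B z0 \<longrightarrow> conjugate br B z0 x0 t \<longrightarrow>
          mult_cp br B z0 x0 t = 1) \<and>
       (\<forall>l\<in>lambdas br B z0. \<forall>n::int. n \<noteq> 0 \<longrightarrow>
          (let t = 2 * pi / l * of_int n; S = Ssum br B z0 l n in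
            (x0 \<notin> {expJ br B z0 (- t) w - w | w. w \<in> vpart br B} \<longrightarrow>
               mult_cp br B z0 x0 t = S - 1) \<and>
            (\<forall>v\<in>vpart br B. expJ br B z0 (- t) v - v = t *\<^sub>R x0 \<longrightarrow>
               mult_cp br B z0 x0 t =
                 (if B (Jop br B z0 x0) v = B z0 z0 + B x0 x0 then S + 1 else S)))))"
proof (intro conjI impI)
  assume c: "z0 \<noteq> 0 \<and> x0 = 0"
  interpret metric_two_step_geodesic br B z0 1 x0
    by unfold_locales (use assms c in auto)
  have P: "{p. sol p t = 0} = K t" if "t \<noteq> 0" for t
    using c that by (intro zero_set_central) auto
  show "\<forall>t. conjugate br B z0 x0 t \<longleftrightarrow> t \<in> conj_times br B z0"
    using conjugate_iff_dim conj_times_iff_K P by (simp del: dim_eq_0) metis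
  show "\<forall>l\<in>lambdas br B z0. \<forall>n::int. n \<noteq> 0 \<longrightarrow>
          mult_cp br B z0 x0 (2 * pi / l * of_int n) = Ssum br B z0 l n \<and>
          Ssum br B z0 l n \<le> dim (vpart br B)"
  proof (intro ballI allI impI)
    fix l and n :: int assume l: "l \<in> lambdas br B z0" and n: "n \<noteq> 0"
    let ?t = "2 * pi / l * of_int n"
    have t: "?t \<noteq> 0" using l n by (simp add: lambdas_def)
    have S: "Ssum br B z0 l n = dim (K ?t)" using Ssum_eq[of l n] l n by simp
    have "mult_cp br B z0 x0 ?t = dim (K ?t)" using mult_cp_eq[of ?t] unfolding P[OF t] by simp
    then show "mult_cp br B z0 x0 ?t = Ssum br B z0 l n \<and> Ssum br B z0 l n \<le> dim V"
      unfolding S using dim_K_le by simp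
  qed
next
  assume c: "z0 = 0 \<and> x0 \<noteq> 0"
  show "\<forall>z\<in>center br. B z z \<in> {1, -1} \<longrightarrow>
         (\<forall>t. t \<noteq> 0 \<longrightarrow>
           (conjugate br B z0 x0 t \<longleftrightarrow>
              - 12 / t^2 = B z z * B (Jop br B z x0) (Jop br B z x0)) \<and>
           (conjugate br B z0 x0 t \<longrightarrow> mult_cp br B z0 x0 t = 1))"
  proof (intro ballI allI impI)
    fix z and t :: real assume z: "z \<in> center br" "B z z \<in> {1, -1}" and t: "t \<noteq> 0"
    have "bilinear B" using ip unfolding inner_product_def by blast
    then have "z \<noteq> 0" using z(2) bilinear_lzero[of B] by auto
    \<comment> \<open>Here \<open>z0 = 0 *\<^sub>R z\<close>, so the flow is trivial, while
      \<open>L\<close> is the operator of the unit vector \<open>z\<close>.\<close>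
    then interpret metric_two_step_geodesic br B z 0 x0
      by unfold_locales (use assms z in auto)
    let ?Q = "B (L x0) (L x0)"
    let ?w = "z - (t / 2) *\<^sub>R L x0"
    have "B z ?w \<noteq> 0" using z(2) by (auto simp: B_simps)
    then have "?w \<noteq> 0" by (metis bilinear_rzero[OF bilinear_B])
    then have "?w \<notin> span {}" by (simp add: span_empty)
    then have d: "dim (span {?w}) = 1" by (simp only: dim_span dim_insert if_False dim_empty)
    \<comment> \<open>As \<open>B z z\<close> is 1 or -1, multiplying by it and dividing by it
      agree.\<close>
    have iff: "- 12 / t^2 = B z z * ?Q \<longleftrightarrow> B z z + t\<^sup>2 / 12 * ?Q = 0"
      using z(2) t by (auto simp: field_simps)
    have dz: "dim {p. sol p t = 0} = (if - 12 / t^2 = B z z * ?Q then 1 else 0)"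
      unfolding zero_set_horizontal[OF refl t] iff using d by (simp del: dim_span)
    have "conjugate br B z0 x0 t \<longleftrightarrow> dim {p. sol p t = 0} \<noteq> 0"
      using conjugate_iff_dim[of t] c t by simp
    moreover have "mult_cp br B z0 x0 t = dim {p. sol p t = 0}" using mult_cp_eq[of t] c by simp
    ultimately show "(conjugate br B z0 x0 t \<longleftrightarrow> - 12 / t^2 = B z z * ?Q) \<and>
        (conjugate br B z0 x0 t \<longrightarrow> mult_cp br B z0 x0 t = 1)"
      unfolding dz by simp
  qed
next
  assume c: "z0 \<noteq> 0 \<and> x0 \<noteq> 0 \<and> (\<forall>x\<in>vpart br B. Jop br B z0 x = 0 \<longrightarrow> x = 0)"
  interpret metric_two_step_invertible br B z0 1 x0
    by unfold_locales (use assms c in auto)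
  have E: "expJ br B z0 = E" by (intro ext) (simp add: expJ_eq)
  have K0: "dim (K t) = 0 \<longleftrightarrow> t \<notin> conj_times br B z0" if "t \<noteq> 0" for t
    using conj_times_iff_K[of t] that by simp
  have mult: "mult_cp br B z0 x0 t = dim {p. sol p t = 0}" for t using mult_cp_eq[of t] by simp
  have conj: "conjugate br B z0 x0 t \<longleftrightarrow> t \<noteq> 0 \<and> mult_cp br B z0 x0 t \<noteq> 0" for t
    using conjugate_iff_dim[of t] mult by simp
  have ex1: "\<exists>!w. w \<in> V \<and> E (- t) w - w = y" if "t \<noteq> 0" "t \<notin> conj_times br B z0" "y \<in> V" for t y
    by (rule ex1_preimage[OF _ that(3)]) (simp only: K0[OF that(1)] that(2) not_False_eq_True)
  have regular: "mult_cp br B z0 x0 t = (if t * B (L x0) (THE w. w \<in> V \<and> E (- t) w - w = x0) = B z0 z0 + B x0 x0 then 1 else 0)"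
    if t: "t \<noteq> 0" "t \<notin> conj_times br B z0" for t
  proof -
    define w where "w = (THE w. w \<in> V \<and> E (- t) w - w = x0)"
    have w: "w \<in> V" "E (- t) w - w = x0"
      using theI'[OF ex1[OF t x0]] unfolding w_def by blast+
    \<comment> \<open>The preimage of \<open>t x0\<close> is \<open>t\<close> times that of
      \<open>x0\<close>; as the kernel is trivial at such times, the dimension formula gives 0 or
      1.\<close>
    have "E (- t) (t *\<^sub>R w) - t *\<^sub>R w = t *\<^sub>R (E (- t) w - w)" by (simp only: E_simps scaleR_diff_right)
    then have "E (- t) (t *\<^sub>R w) - t *\<^sub>R w = t *\<^sub>R x0" unfolding w(2) .
    then have "mult_cp br B z0 x0 t = (if B (L x0) (t *\<^sub>R w) = energy then dim (K t) + 1 else dim (K t))"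
      unfolding mult by (rule dim_zero_set_range[OF t(1) subspace_scale[OF subspace_V w(1)]])
    then show ?thesis
      using K0[OF t(1)] t(2) unfolding w_def[symmetric] energy_def by (simp add: B_simps)
  qed
  have singular: "mult_cp br B z0 x0 t \<noteq> 0" if "t \<noteq> 0" "t \<in> conj_times br B z0" for t
    using conjugate_iff_range[OF that(1)] K0[OF that(1)] that conj[of t] by simp
  show "\<forall>t. t \<noteq> 0 \<longrightarrow>
          (conjugate br B z0 x0 t \<longleftrightarrow>
             t \<in> conj_times br B z0 \<or>
             (t \<notin> conj_times br B z0 \<and>
              t * B (Jop br B z0 x0)
                    (THE w. w \<in> vpart br B \<and> expJ br B z0 (- t) w - w = x0)
                = B z0 z0 + B x0 x0))"
  proof (intro allI impI)
    fix t :: real assume t: "t \<noteq> 0"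
    show "conjugate br B z0 x0 t \<longleftrightarrow>
             t \<in> conj_times br B z0 \<or>
             (t \<notin> conj_times br B z0 \<and>
              t * B (Jop br B z0 x0)
                    (THE w. w \<in> vpart br B \<and> expJ br B z0 (- t) w - w = x0)
                = B z0 z0 + B x0 x0)"
    proof (cases "t \<in> conj_times br B z0")
      case True
      then show ?thesis using singular[OF t] conj[of t] t by simp
    next
      case False
      show ?thesis unfolding conj regular[OF t False] E using t False by simp
    qed
  qed
  show "\<forall>t. t \<noteq> 0 \<longrightarrow> t \<notin> conj_times br B z0 \<longrightarrow>
          (\<forall>y\<in>vpart br B. \<exists>!w. w \<in> vpart br B \<and> expJ br B z0 (- t) w - w = y)"
    unfolding E using ex1 by blast
  show "\<forall>t. t \<noteq> 0 \<longrightarrow> t \<notin> conj_times br B z0 \<longrightarrow> conjugate br B z0 x0 t \<longrightarrow>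
          mult_cp br B z0 x0 t = 1"
  proof (intro allI impI)
    fix t :: real assume t: "t \<noteq> 0" "t \<notin> conj_times br B z0" and cj: "conjugate br B z0 x0 t"
    have "mult_cp br B z0 x0 t \<noteq> 0" using cj conj by blast
    then show "mult_cp br B z0 x0 t = 1" unfolding regular[OF t] by presburger
  qed
  show "\<forall>l\<in>lambdas br B z0. \<forall>n::int. n \<noteq> 0 \<longrightarrow>
          (let t = 2 * pi / l * of_int n; S = Ssum br B z0 l n in
            (x0 \<notin> {expJ br B z0 (- t) w - w | w. w \<in> vpart br B} \<longrightarrow>
               mult_cp br B z0 x0 t = S - 1) \<and>
            (\<forall>v\<in>vpart br B. expJ br B z0 (- t) v - v = t *\<^sub>R x0 \<longrightarrow>
               mult_cp br B z0 x0 t =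
                 (if B (Jop br B z0 x0) v = B z0 z0 + B x0 x0 then S + 1 else S)))"
    unfolding Let_def E
  proof (intro ballI allI impI conjI)
    fix l and n :: int assume l: "l \<in> lambdas br B z0" and n: "n \<noteq> 0"
    let ?t = "2 * pi / l * of_int n"
    have t: "?t \<noteq> 0" using l n by (simp add: lambdas_def)
    have S: "Ssum br B z0 l n = dim (K ?t)" using Ssum_eq[of l n] l n by simp
    show "mult_cp br B z0 x0 ?t = Ssum br B z0 l n - 1"
      if nr: "x0 \<notin> {E (- ?t) w - w | w. w \<in> vpart br B}"
    proof -
      \<comment> \<open>In this form the kernel has dimension at least 1, so the natural-number
        subtraction \<open>S - 1\<close> is not truncated.\<close>
      have "dim (K ?t) = dim {p. sol p ?t = 0} + 1"
        by (rule dim_zero_set_not_range[OF t]) (use nr in blast)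
      then show ?thesis unfolding mult S by simp
    qed
    show "mult_cp br B z0 x0 ?t = (if B (L x0) v = B z0 z0 + B x0 x0 then Ssum br B z0 l n + 1 else Ssum br B z0 l n)"
      if v: "v \<in> V" "E (- ?t) v - v = ?t *\<^sub>R x0" for v
      unfolding mult S dim_zero_set_range[OF t v] energy_def ..
  qed
qed

end
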